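(* Let $\mu$ be a probability distribution on $\mathbb{R}^d$ with finite second moments and $X \sim \mu$. Fix $n \ge 1$, $T > 0$ and $\alpha > 0$ with $\alpha \ne 1$, and let $t_k = \frac{\alpha^k - 1}{\alpha^n - 1}T$ for $k = 0,1,\dots,n$ and $\delta_k = t_k - t_{k-1}$ for $k=1,\dots,n$. Let $N_1,\dots,N_n$ be i.i.d. standard Gaussian vectors independent of $X$, and define $Y_0 = 0$, $Y_k = Y_{k-1} + \delta_k X + \sqrt{\delta_k}N_k$. Let $f_k(y) = \mathbb{E}[X \mid Y_{k-1} = y]$ (the conditional mean estimator), let $\tilde N_1,\dots,\tilde N_n$ be i.i.d. standard Gaussian vectors, and define $Z_0 = 0$, $Z_k = Z_{k-1} + \delta_k f_k(Z_{k-1}) + \sqrt{\delta_k}\tilde N_k$. Let $\Delta_n = D(\mathrm{Law}(Y_1,\dots,Y_n)\,\|\,\mathrm{Law}(Z_1,\dots,Z_n))$. Then $$\Delta_n \le (\alpha - 1)\left(\frac{T\,(M(0) - M(T))}{2(\alpha^n - 1)} + I(T) - \frac{T\,M(T)}{2}\right).$$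
   Context: For $s \ge 0$, with $X\sim\mu$ and $N \sim \mathsf{N}(0,\mathrm{I})$ independent, $M(s) = \mathbb{E}\|X - \mathbb{E}[X \mid \sqrt{s}X + N]\|^2$ is the MMSE function and $I(s) = I(X;\sqrt{s}X + N)$ is the mutual information (in nats). $D(\cdot\|\cdot)$ is the Kullback–Leibler divergence. *)

theory Defs
  imports "HOL-Probability.Probability"
begin

definition std_gauss :: "'a::euclidean_space measure" where
  "std_gauss = density lborel
     (\<lambda>x. ennreal ((2 * pi) powr (- real DIM('a) / 2) * exp (- (norm x)\<^sup>2 / 2)))"

definition KL_div :: "'a measure \<Rightarrow> 'a measure \<Rightarrow> ereal" where
  "KL_div P Q =
     (if absolutely_continuous Q P \<and> integrable P (\<lambda>x. ln (enn2real (RN_deriv Q P x)))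
      then ereal (\<integral>x. ln (enn2real (RN_deriv Q P x)) \<partial>P)
      else \<infinity>)"

definition chan_space :: "'a::euclidean_space measure \<Rightarrow> ('a \<times> 'a) measure" where
  "chan_space \<mu> = \<mu> \<Otimes>\<^sub>M std_gauss"

definition chan_out :: "real \<Rightarrow> 'a::euclidean_space \<times> 'a \<Rightarrow> 'a" where
  "chan_out s = (\<lambda>(x, z). sqrt s *\<^sub>R x + z)"

definition mmse :: "'a::euclidean_space measure \<Rightarrow> real \<Rightarrow> real" where
  "mmse \<mu> s =
     (\<Sum>b\<in>Basis.
        \<integral>\<omega>. (fst \<omega> \<bullet> b
              - real_cond_exp (chan_space \<mu>)
                  (vimage_algebra (space (chan_space \<mu>)) (chan_out s) borel)
                  (\<lambda>\<omega>'. fst \<omega>' \<bullet> b) \<omega>)\<^sup>2 \<partial>chan_space \<mu>)"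

definition mutual_info :: "'a::euclidean_space measure \<Rightarrow> real \<Rightarrow> ereal" where
  "mutual_info \<mu> s =
     KL_div (distr (chan_space \<mu>) (borel \<Otimes>\<^sub>M borel) (\<lambda>\<omega>. (fst \<omega>, chan_out s \<omega>)))
            (\<mu> \<Otimes>\<^sub>M distr (chan_space \<mu>) borel (chan_out s))"

definition tgrid :: "real \<Rightarrow> nat \<Rightarrow> real \<Rightarrow> nat \<Rightarrow> real" where
  "tgrid \<alpha> n T k = (\<alpha> ^ k - 1) / (\<alpha> ^ n - 1) * T"

definition tstep :: "real \<Rightarrow> nat \<Rightarrow> real \<Rightarrow> nat \<Rightarrow> real" where
  "tstep \<alpha> n T k = tgrid \<alpha> n T k - tgrid \<alpha> n T (k - 1)"

fun Yproc :: "(nat \<Rightarrow> real) \<Rightarrow> ('b \<Rightarrow> 'a::real_normed_vector) \<Rightarrow> (nat \<Rightarrow> 'b \<Rightarrow> 'a)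
              \<Rightarrow> nat \<Rightarrow> 'b \<Rightarrow> 'a" where
  "Yproc \<delta> X N 0 \<omega> = 0"
| "Yproc \<delta> X N (Suc k) \<omega> =
     Yproc \<delta> X N k \<omega> + \<delta> (Suc k) *\<^sub>R X \<omega> + sqrt (\<delta> (Suc k)) *\<^sub>R N (Suc k) \<omega>"

fun Zproc :: "(nat \<Rightarrow> real) \<Rightarrow> (nat \<Rightarrow> 'a \<Rightarrow> 'a::real_normed_vector) \<Rightarrow> (nat \<Rightarrow> 'b \<Rightarrow> 'a)
              \<Rightarrow> nat \<Rightarrow> 'b \<Rightarrow> 'a" where
  "Zproc \<delta> f N 0 \<omega> = 0"
| "Zproc \<delta> f N (Suc k) \<omega> =
     Zproc \<delta> f N k \<omega> + \<delta> (Suc k) *\<^sub>R f (Suc k) (Zproc \<delta> f N k \<omega>)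
       + sqrt (\<delta> (Suc k)) *\<^sub>R N (Suc k) \<omega>"

definition path_law :: "'b measure \<Rightarrow> nat \<Rightarrow> (nat \<Rightarrow> 'b \<Rightarrow> 'a::topological_space) \<Rightarrow> (nat \<Rightarrow> 'a) measure" where
  "path_law M n V = distr M (\<Pi>\<^sub>M k\<in>{1..n}. borel) (\<lambda>\<omega>. \<lambda>k\<in>{1..n}. V k \<omega>)"

end

theory Submission
  imports Defs
begin

text \<open>
  Let \<open>U\<^sub>t = \<surd>t X + N\<close>. Relative to the Gaussian random walk the law of \<open>Y\<close> has density \<open>p\<^sub>T(y\<^sub>n)\<close>, where
  \<open>p\<^sub>t(y) = E exp (X \<bullet> y - t |X|\<^sup>2 / 2)\<close>, and the law of \<open>Z\<close> has a Girsanov density; hence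
  \<open>\<Delta>\<^sub>n = \<Sum>\<^sub>k \<delta>\<^sub>k M(t\<^sub>k\<^sub>-\<^sub>1) / 2 - I(T)\<close>. Since \<open>\<delta>\<^sub>k\<^sub>+\<^sub>1 = \<alpha> \<delta>\<^sub>k\<close>, the claim is equivalent to
  \<open>I(T) \<ge> \<Sum>\<^sub>k \<delta>\<^sub>k M(t\<^sub>k) / 2\<close>, so it suffices that \<open>I(t) - I(s) \<ge> (t - s) M(t) / 2\<close> for \<open>s \<le> t\<close>.

  This follows without differentiating \<open>I\<close>. We have \<open>I(t) = t E|X|\<^sup>2 / 2 - E ln r\<^sub>t(U\<^sub>t)\<close> for the density \<open>r\<^sub>t\<close> of
  \<open>U\<^sub>t\<close> relative to \<open>N\<close>. Gibbs' inequality gives \<open>E ln r\<^sub>s(U\<^sub>s) \<ge> E ln r\<^sub>t(U\<^sub>s)\<close>, and convexity of \<open>ln r\<^sub>t\<close>, whose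
  gradient at \<open>U\<^sub>t\<close> is \<open>\<surd>t E[X | U\<^sub>t]\<close>, gives
  \<open>E ln r\<^sub>t(U\<^sub>t) - E ln r\<^sub>t(U\<^sub>s) \<le> \<surd>t (\<surd>t - \<surd>s) E|E[X | U\<^sub>t]|\<^sup>2\<close> when both outputs use the same noise. As \<open>M\<close> is
  decreasing, the resulting error, of order \<open>(\<surd>t - \<surd>s)\<^sup>2\<close>, disappears under refinement of \<open>[s, t]\<close>.
\<close>

section \<open>The standard Gaussian measure\<close>

text \<open>The equivalence with a lower bound on I(T) is an index shift: as each step is \<alpha>
  times the previous one, the left Riemann sum of M/2 is \<alpha> times the right one up to boundary
  terms. Only \<alpha> > 0 enters there, so both signs of \<alpha> - 1 are covered at once. The
  bound on increments is the one-sided, integrated form of the I-MMSE relation I' = M/2, with M at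
  the right endpoint. Levels enter through their square roots because outputs driven by the same
  noise differ by (sqrt t - sqrt s) X. Convexity then yields the coefficient v (v - w) in place of
  the desired (v^2 - w^2)/2; the discrepancy is (v - w)^2/2, which is what makes subdivision
  effective. A finite second moment gives no exponential moments of X, so domination comes from
  completing the square: at the point sqrt t u the likelihood is at most exp(|u|^2/2) whatever X is.
  Together with a supporting hyperplane of ln r_t this bounds |ln r_t| by a quadratic function, so
  that all logarithmic expectations are finite.\<close>

lemma nn_integral_lborel_affine:
  fixes f :: "'a::euclidean_space \<Rightarrow> ennreal"
  assumes [measurable]: "f \<in> borel_measurable borel" and c: "c \<noteq> 0"
  shows "(\<integral>\<^sup>+x. f x \<partial>lborel) = ennreal (\<bar>c\<bar> ^ DIM('a)) * (\<integral>\<^sup>+x. f (t + c *\<^sub>R x) \<partial>lborel)"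
  by (subst lborel_affine[OF c, of t])
     (simp add: nn_integral_density nn_integral_distr nn_integral_cmult)

definition gauss_density :: "'a::euclidean_space \<Rightarrow> real" where
  "gauss_density x = (2 * pi) powr (- real DIM('a) / 2) * exp (- (norm x)\<^sup>2 / 2)"

lemma borel_measurable_gauss_density [measurable]: "gauss_density \<in> borel_measurable borel"
  by (simp add: gauss_density_def[abs_def])

lemma gauss_density_nonneg [simp]: "0 \<le> gauss_density x"
  by (simp add: gauss_density_def)

lemma gauss_density_minus [simp]: "gauss_density (- x) = gauss_density x"
  by (simp add: gauss_density_def)

lemma std_gauss_eq_density: "std_gauss = density lborel (\<lambda>x. ennreal (gauss_density x))"
  by (simp add: std_gauss_def gauss_density_def)

lemma sets_std_gauss [simp, measurable_cong]: "sets std_gauss = sets borel"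
  and space_std_gauss [simp]: "space std_gauss = UNIV"
  by (simp_all add: std_gauss_def)

lemma nn_integral_std_gauss:
  fixes g :: "'a::euclidean_space \<Rightarrow> ennreal"
  assumes [measurable]: "g \<in> borel_measurable borel"
  shows "(\<integral>\<^sup>+x. g x \<partial>std_gauss) = (\<integral>\<^sup>+x. gauss_density x * g x \<partial>lborel)"
  by (simp add: std_gauss_eq_density nn_integral_density)

lemma power2_norm_eq_sum: "(norm x)\<^sup>2 = (\<Sum>b\<in>Basis. (x \<bullet> b)\<^sup>2)" for x :: "'a::euclidean_space"
  unfolding power2_norm_eq_inner by (subst euclidean_inner) (simp add: power2_eq_square)

lemma prob_space_std_gauss: "prob_space (std_gauss :: 'a::euclidean_space measure)"
proof
  have *: "gauss_density x = (\<Prod>b\<in>Basis. std_normal_density (x \<bullet> b))" for x :: 'a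
  proof -
    have "(\<Prod>b\<in>(Basis::'a set). 1 / sqrt (2 * pi)) = (2 * pi) powr (- real DIM('a) / 2)"
      by (simp add: powr_half_sqrt[symmetric] powr_minus_divide powr_powr power_divide
          powr_realpow[symmetric] divide_simps mult.commute)
    moreover have "(\<Prod>b\<in>Basis. exp (- (x \<bullet> b)\<^sup>2 / 2)) = exp (- (norm x)\<^sup>2 / 2)"
      by (simp add: power2_norm_eq_sum exp_sum[symmetric] sum_negf sum_divide_distrib[symmetric])
    ultimately show ?thesis
      by (simp add: gauss_density_def std_normal_density_def prod_dividef power_divide divide_simps mult.commute)
  qed
  have "emeasure (std_gauss :: 'a measure) (space std_gauss)
      = (\<integral>\<^sup>+x. (\<Prod>b\<in>Basis. ennreal (std_normal_density ((x::'a) \<bullet> b))) \<partial>lborel)"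
    by (simp add: std_gauss_eq_density emeasure_density * prod_ennreal)
  also have "\<dots> = (\<Prod>b\<in>(Basis::'a set). (\<integral>\<^sup>+x. ennreal (std_normal_density x) \<partial>lborel))"
    by (rule nn_integral_lborel_prod) auto
  also have "(\<integral>\<^sup>+x. ennreal (std_normal_density x) \<partial>lborel) = 1"
    using prob_space.emeasure_space_1[OF prob_space_normal_density[of 1 0]]
    by (simp add: emeasure_density)
  finally show "emeasure (std_gauss :: 'a measure) (space std_gauss) = 1"
    by simp
qed

interpretation std_gauss: prob_space "std_gauss :: 'a::euclidean_space measure"
  by (rule prob_space_std_gauss)

lemma nn_integral_gauss_density: "(\<integral>\<^sup>+x. gauss_density (x::'a::euclidean_space) \<partial>lborel) = 1"
  using std_gauss.emeasure_space_1 by (simp add: std_gauss_eq_density emeasure_density)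

text \<open>The Cameron-Martin formula: the exponential is the quotient of the Gaussian densities at
  \<open>x - c\<close> and at \<open>x\<close>. Both the channel likelihood \<open>tilt\<close> and
  the path likelihood \<open>log_lik\<close> arise from it.\<close>

lemma nn_integral_std_gauss_shift:
  fixes g :: "'a::euclidean_space \<Rightarrow> ennreal"
  assumes [measurable]: "g \<in> borel_measurable borel"
  shows "(\<integral>\<^sup>+x. g (c + x) \<partial>std_gauss) = (\<integral>\<^sup>+x. g x * exp (c \<bullet> x - (norm c)\<^sup>2 / 2) \<partial>std_gauss)"
proof -
  have "(\<integral>\<^sup>+x. g x * exp (c \<bullet> x - (norm c)\<^sup>2 / 2) \<partial>std_gauss)
      = (\<integral>\<^sup>+x. ennreal (gauss_density (x - c)) * g x \<partial>lborel)"
  proof (subst nn_integral_std_gauss, measurable, intro nn_integral_cong)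
    fix x
    have "- (norm x)\<^sup>2 / 2 + (c \<bullet> x - (norm c)\<^sup>2 / 2) = - (norm (x - c))\<^sup>2 / 2"
      unfolding power2_norm_eq_inner by (simp add: inner_diff_left inner_diff_right inner_commute field_simps)
    then have "gauss_density x * exp (c \<bullet> x - (norm c)\<^sup>2 / 2) = gauss_density (x - c)"
      by (simp add: gauss_density_def mult.assoc exp_add[symmetric])
    then show "ennreal (gauss_density x) * (g x * ennreal (exp (c \<bullet> x - (norm c)\<^sup>2 / 2)))
        = ennreal (gauss_density (x - c)) * g x"
      by (simp add: mult.left_commute[of _ "g x"] ennreal_mult'[symmetric]) (simp add: mult.commute)
  qed
  also have "\<dots> = (\<integral>\<^sup>+x. ennreal (gauss_density x) * g (c + x) \<partial>lborel)"
    by (subst nn_integral_lborel_affine[where c=1 and t=c]) auto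
  finally show ?thesis
    by (simp add: nn_integral_std_gauss)
qed

text \<open>With \<open>u = a x + c z\<close> in place of \<open>z\<close>, the joint density is
  that of two standard vectors with correlation \<open>a\<close>. It is symmetric in
  \<open>x\<close> and \<open>u\<close>, so integrating out \<open>x\<close> leaves the standard
  density at \<open>u\<close>. This serves both to degrade a channel output and to merge the steps
  of a Gaussian walk.\<close>

lemma nn_integral_std_gauss_rotate:
  fixes g :: "'a::euclidean_space \<Rightarrow> ennreal"
  assumes [measurable]: "g \<in> borel_measurable borel" and ac: "a\<^sup>2 + c\<^sup>2 = 1"
  shows "(\<integral>\<^sup>+x. \<integral>\<^sup>+z. g (a *\<^sub>R x + c *\<^sub>R z) \<partial>std_gauss \<partial>std_gauss) = (\<integral>\<^sup>+x. g x \<partial>std_gauss)"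
\<comment> \<open>For \<open>c = 0\<close> the substitution of \<open>u\<close> for \<open>z\<close>
  degenerates; then \<open>a\<close> is 1 or -1 and the reflection symmetry of the density is
  enough.\<close>
proof (cases "c = 0")
  case True
  have neg: "(\<integral>\<^sup>+x. g (- x) \<partial>std_gauss) = (\<integral>\<^sup>+x. g x \<partial>std_gauss)"
    by (simp add: nn_integral_std_gauss)
       (subst (2) nn_integral_lborel_affine[where c="-1" and t=0], auto)
  from True ac have "a = 1 \<or> a = -1"
    by (simp add: power2_eq_1_iff)
  then show ?thesis
    using True neg by (auto simp: std_gauss.emeasure_space_1[simplified])
next
  case c: False
  define k :: "'a \<Rightarrow> real" where "k = gauss_density"
  have [measurable]: "k \<in> borel_measurable borel"
    by (simp add: k_def)
  have k0: "0 \<le> k x" for x by (simp add: k_def)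
  define C where "C = \<bar>c\<bar> ^ DIM('a)"
  have C: "C > 0" using c by (simp add: C_def)
  have kk: "k x * k ((1 / c) *\<^sub>R (u - a *\<^sub>R x)) = k u * k ((1 / c) *\<^sub>R (x - a *\<^sub>R u))" for x u
  proof -
    have "- (norm x)\<^sup>2 / 2 + - (norm ((1 / c) *\<^sub>R (u - a *\<^sub>R x)))\<^sup>2 / 2
        = - (norm u)\<^sup>2 / 2 + - (norm ((1 / c) *\<^sub>R (x - a *\<^sub>R u)))\<^sup>2 / 2"
    proof -
      have "c\<^sup>2 * (norm x)\<^sup>2 + (norm (u - a *\<^sub>R x))\<^sup>2 = c\<^sup>2 * (norm u)\<^sup>2 + (norm (x - a *\<^sub>R u))\<^sup>2"
      proof -
        have c2: "c\<^sup>2 = 1 - a\<^sup>2" using ac by simp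
        show ?thesis
          unfolding c2 power2_norm_eq_inner
          by (simp add: inner_diff_left inner_diff_right inner_commute algebra_simps power2_eq_square)
      qed
      then show ?thesis
        using c unfolding norm_scaleR power_mult_distrib
        by (simp add: power_divide field_simps)
    qed
    then show ?thesis
      unfolding k_def gauss_density_def by (simp add: exp_add[symmetric] mult.assoc mult.left_commute[of "exp _"])
  qed
  have 1: "(\<integral>\<^sup>+z. k z * g (a *\<^sub>R x + c *\<^sub>R z) \<partial>lborel)
      = (\<integral>\<^sup>+u. ennreal (1 / C) * (k ((1 / c) *\<^sub>R (u - a *\<^sub>R x)) * g u) \<partial>lborel)" for x
  proof -
    have "(\<integral>\<^sup>+u. ennreal (1 / C) * (k ((1 / c) *\<^sub>R (u - a *\<^sub>R x)) * g u) \<partial>lborel)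
       = ennreal C * (\<integral>\<^sup>+z. ennreal (1 / C) * (k z * g (a *\<^sub>R x + c *\<^sub>R z)) \<partial>lborel)"
      by (subst nn_integral_lborel_affine[where c=c and t="a *\<^sub>R x"]) (use c in \<open>auto simp: C_def ennreal_power\<close>)
    also have "\<dots> = (ennreal C * ennreal (1 / C)) * (\<integral>\<^sup>+z. (k z * g (a *\<^sub>R x + c *\<^sub>R z)) \<partial>lborel)"
      by (subst nn_integral_cmult) (auto simp: mult.assoc)
    also have "ennreal C * ennreal (1 / C) = 1"
      using C by (simp add: ennreal_mult'[symmetric])
    finally show ?thesis by simp
  qed
  have 2: "(\<integral>\<^sup>+x. ennreal (1 / C) * k ((1 / c) *\<^sub>R (x - a *\<^sub>R u)) \<partial>lborel) = 1" for u
  proof -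
    have "(\<integral>\<^sup>+x. ennreal (1 / C) * k ((1 / c) *\<^sub>R (x - a *\<^sub>R u)) \<partial>lborel)
       = ennreal C * (\<integral>\<^sup>+z. ennreal (1 / C) * k z \<partial>lborel)"
      by (subst nn_integral_lborel_affine[where c=c and t="a *\<^sub>R u"]) (use c in \<open>auto simp: C_def ennreal_power\<close>)
    also have "\<dots> = (ennreal C * ennreal (1 / C)) * (\<integral>\<^sup>+z. k z \<partial>lborel)"
      by (subst nn_integral_cmult) (auto simp: mult.assoc)
    also have "ennreal C * ennreal (1 / C) = 1"
      using C by (simp add: ennreal_mult'[symmetric])
    finally show ?thesis
      by (simp add: k_def nn_integral_gauss_density)
  qed
  have "(\<integral>\<^sup>+x. \<integral>\<^sup>+z. g (a *\<^sub>R x + c *\<^sub>R z) \<partial>std_gauss \<partial>std_gauss)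
      = (\<integral>\<^sup>+x. k x * (\<integral>\<^sup>+z. k z * g (a *\<^sub>R x + c *\<^sub>R z) \<partial>lborel) \<partial>lborel)"
    by (simp add: nn_integral_std_gauss k_def)
  also have "\<dots> = (\<integral>\<^sup>+x. (\<integral>\<^sup>+u. (k u * g u) * (ennreal (1 / C) * k ((1 / c) *\<^sub>R (x - a *\<^sub>R u))) \<partial>lborel) \<partial>lborel)"
    unfolding 1
  proof (intro nn_integral_cong, subst nn_integral_cmult[symmetric], measurable, intro nn_integral_cong)
    fix x u
    have "ennreal (k x) * (ennreal (1 / C) * (ennreal (k ((1 / c) *\<^sub>R (u - a *\<^sub>R x))) * g u))
       = ennreal (k x * k ((1 / c) *\<^sub>R (u - a *\<^sub>R x))) * (ennreal (1 / C) * g u)"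
      by (simp add: ennreal_mult k0 ac_simps)
    also have "\<dots> = ennreal (k u) * g u * (ennreal (1 / C) * ennreal (k ((1 / c) *\<^sub>R (x - a *\<^sub>R u))))"
      by (simp add: kk ennreal_mult k0 ac_simps)
    finally show "ennreal (k x) * (ennreal (1 / C) * (ennreal (k ((1 / c) *\<^sub>R (u - a *\<^sub>R x))) * g u)) = \<dots>" .
  qed
  also have "\<dots> = (\<integral>\<^sup>+u. (\<integral>\<^sup>+x. (k u * g u) * (ennreal (1 / C) * k ((1 / c) *\<^sub>R (x - a *\<^sub>R u))) \<partial>lborel) \<partial>lborel)"
    by (rule lborel_pair.Fubini') measurable
  also have "\<dots> = (\<integral>\<^sup>+u. k u * g u \<partial>lborel)"
    by (intro nn_integral_cong, subst nn_integral_cmult, measurable) (simp add: 2)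
  finally show ?thesis
    by (simp add: nn_integral_std_gauss k_def)
qed

lemma distr_std_gauss_uminus: "distr std_gauss borel uminus = (std_gauss :: 'a::euclidean_space measure)"
proof (rule measure_eqI)
  fix A :: "'a set" assume "A \<in> sets (distr std_gauss borel uminus)"
  then have [measurable]: "A \<in> sets borel" by simp
  show "emeasure (distr std_gauss borel uminus) A = emeasure std_gauss A"
    using nn_integral_std_gauss_rotate[of "indicator A" "-1" 0]
    by (simp add: nn_integral_distr std_gauss.emeasure_space_1[simplified] flip: nn_integral_indicator)
qed simp

lemma integrable_std_gauss_norm2: "integrable std_gauss (\<lambda>x::'a::euclidean_space. (norm x)\<^sup>2)"
proof (rule integrableI_bounded)
  have "(\<integral>\<^sup>+x. ennreal (norm ((norm x)\<^sup>2)) \<partial>(std_gauss::'a measure))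
     \<le> (\<integral>\<^sup>+x. 4 * ennreal (gauss_density ((1 / sqrt 2) *\<^sub>R (x::'a))) \<partial>lborel)"
  proof (subst nn_integral_std_gauss, measurable, intro nn_integral_mono)
    fix x :: 'a
    \<comment> \<open>Trading the square for \<open>exp ((norm x)\<^sup>2 / 4)\<close> leaves half
      of the Gaussian exponent, which is the exponent at \<open>x / sqrt 2\<close>; a dilation by
      \<open>sqrt 2\<close> then computes the integral.\<close>
    have "(norm x)\<^sup>2 \<le> 4 * exp ((norm x)\<^sup>2 / 4)"
      using exp_ge_add_one_self[of "(norm x)\<^sup>2 / 4"] by linarith
    then have "exp (- (norm x)\<^sup>2 / 2) * (norm x)\<^sup>2 \<le> exp (- (norm x)\<^sup>2 / 2) * (4 * exp ((norm x)\<^sup>2 / 4))"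
      by (intro mult_left_mono) auto
    also have "\<dots> = 4 * exp (- (norm ((1 / sqrt 2) *\<^sub>R x))\<^sup>2 / 2)"
      by (simp add: exp_add[symmetric] power_mult_distrib power_divide)
    finally have "gauss_density x * (norm x)\<^sup>2 \<le> 4 * gauss_density ((1 / sqrt 2) *\<^sub>R x)"
      by (simp add: gauss_density_def mult.assoc mult.left_commute[of 4])
    then show "ennreal (gauss_density x) * ennreal (norm ((norm x)\<^sup>2))
        \<le> 4 * ennreal (gauss_density ((1 / sqrt 2) *\<^sub>R x))"
      by (subst ennreal_mult'[symmetric], simp, subst ennreal_numeral[symmetric], subst ennreal_mult'[symmetric])
         (auto intro!: ennreal_leI)
  qed
  also have "\<dots> = 4 * (\<integral>\<^sup>+x. ennreal (gauss_density ((1 / sqrt 2) *\<^sub>R (x::'a))) \<partial>lborel)"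
    by (rule nn_integral_cmult) measurable
  also have "(\<integral>\<^sup>+x. ennreal (gauss_density ((1 / sqrt 2) *\<^sub>R (x::'a))) \<partial>lborel) = ennreal (\<bar>sqrt 2\<bar> ^ DIM('a)) * 1"
    by (subst nn_integral_lborel_affine[where c="sqrt 2" and t=0])
       (auto simp: nn_integral_gauss_density[simplified] ennreal_power)
  finally show "(\<integral>\<^sup>+x. ennreal (norm ((norm x)\<^sup>2)) \<partial>(std_gauss::'a measure)) < \<infinity>"
    by (rule order.strict_trans1) (auto simp: ennreal_power ennreal_mult_less_top)
qed simp

lemma integral_std_gauss_inner: "(\<integral>x. x \<bullet> b \<partial>std_gauss) = (0::real)" for b :: "'a::euclidean_space"
proof -
  have "(\<integral>x. x \<bullet> b \<partial>std_gauss) = (\<integral>x. x \<bullet> b \<partial>distr std_gauss borel uminus)"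
    by (simp add: distr_std_gauss_uminus)
  also have "\<dots> = (\<integral>x. - x \<bullet> b \<partial>std_gauss)"
    by (rule integral_distr) simp_all
  finally show ?thesis by simp
qed

section \<open>The Gaussian channel\<close>

lemma power2_norm_diff: "(norm (x - y))\<^sup>2 = (norm x)\<^sup>2 - 2 * (x \<bullet> y) + (norm y)\<^sup>2" for x y :: "'a::real_inner"
  unfolding power2_norm_eq_inner by (simp add: inner_diff_left inner_diff_right inner_commute)

lemma integrable_inner_square_integrable:
  fixes f g :: "'b \<Rightarrow> 'a::euclidean_space"
  assumes [measurable]: "f \<in> borel_measurable M" "g \<in> borel_measurable M"
    and "integrable M (\<lambda>x. (norm (f x))\<^sup>2)" "integrable M (\<lambda>x. (norm (g x))\<^sup>2)"
  shows "integrable M (\<lambda>x. f x \<bullet> g x)"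
proof (rule Bochner_Integration.integrable_bound)
  show "integrable M (\<lambda>x. (norm (f x))\<^sup>2 + (norm (g x))\<^sup>2)"
    using assms(3,4) by (rule Bochner_Integration.integrable_add)
  show "AE x in M. norm (f x \<bullet> g x) \<le> norm ((norm (f x))\<^sup>2 + (norm (g x))\<^sup>2)"
  proof (rule AE_I2)
    fix x
    have "\<bar>f x \<bullet> g x\<bar> \<le> norm (f x) * norm (g x)" by (rule Cauchy_Schwarz_ineq2)
    also have "\<dots> \<le> (norm (f x))\<^sup>2 + (norm (g x))\<^sup>2"
      using sum_squares_bound[of "norm (f x)" "norm (g x)"]
        zero_le_power2[of "norm (f x)"] zero_le_power2[of "norm (g x)"]
      by linarith
    finally show "norm (f x \<bullet> g x) \<le> norm ((norm (f x))\<^sup>2 + (norm (g x))\<^sup>2)" by simp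
  qed
qed simp

lemma integrable_norm2_sum_Basis:
  fixes f :: "'b \<Rightarrow> 'a::euclidean_space"
  assumes "\<And>b. b \<in> Basis \<Longrightarrow> integrable M (\<lambda>x. (f x \<bullet> b)\<^sup>2)"
  shows "integrable M (\<lambda>x. (norm (f x))\<^sup>2)"
  unfolding power2_norm_eq_sum using assms by auto

lemma integrable_inner_Basis_square:
  fixes f :: "'b \<Rightarrow> 'a::euclidean_space"
  assumes [measurable]: "f \<in> borel_measurable M"
    and "integrable M (\<lambda>x. (norm (f x))\<^sup>2)" and b: "b \<in> Basis"
  shows "integrable M (\<lambda>x. (f x \<bullet> b)\<^sup>2)"
proof (rule Bochner_Integration.integrable_bound[OF assms(2)])
  have "\<bar>f x \<bullet> b\<bar>\<^sup>2 \<le> (norm (f x))\<^sup>2" for x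
    using b by (intro power_mono Basis_le_norm) auto
  then show "AE x in M. norm ((f x \<bullet> b)\<^sup>2) \<le> norm ((norm (f x))\<^sup>2)"
    by simp
qed simp

text \<open>The events generated by \<open>V\<close> are exactly the preimages of Borel sets, so
  testing on indicators of \<open>V\<close> is enough. It identifies the posterior mean both for the
  channel and for the process \<open>Y\<close>.\<close>

lemma (in prob_space) real_cond_exp_vimage_algebra_eqI:
  assumes [measurable]: "V \<in> M \<rightarrow>\<^sub>M borel" "g \<in> borel_measurable borel"
    and Z: "integrable M Z" and gV: "integrable M (\<lambda>\<omega>. g (V \<omega>))"
    and eq: "\<And>B. B \<in> sets borel \<Longrightarrow>
      (\<integral>\<omega>. indicator B (V \<omega>) * Z \<omega> \<partial>M) = (\<integral>\<omega>. indicator B (V \<omega>) * g (V \<omega>) \<partial>M)"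
  shows "AE \<omega> in M. real_cond_exp M (vimage_algebra (space M) V borel) Z \<omega> = g (V \<omega>)"
proof -
  let ?F = "vimage_algebra (space M) V borel"
  have sub: "subalgebra M ?F"
    unfolding subalgebra_def
    by (auto simp: sets_vimage_algebra2 intro!: measurable_sets[of V M borel])
  interpret finite_measure_subalgebra M ?F
    by unfold_locales (rule sub)
  show ?thesis
  proof (rule real_cond_exp_charact[OF _ Z gV])
    show "(\<lambda>\<omega>. g (V \<omega>)) \<in> borel_measurable ?F"
      by (rule measurable_compose[OF measurable_vimage_algebra1 assms(2)]) auto
    fix A assume "A \<in> sets ?F"
    then obtain B where B: "B \<in> sets borel" "A = V -` B \<inter> space M"
      by (auto simp: sets_vimage_algebra2)
    have ind: "\<omega> \<in> space M \<Longrightarrow> indicator A \<omega> = (indicator B (V \<omega>) :: real)" for \<omega>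
      using B by (auto simp: indicator_def)
    show "(\<integral>\<omega>\<in>A. Z \<omega> \<partial>M) = (\<integral>\<omega>\<in>A. g (V \<omega>) \<partial>M)"
      unfolding set_lebesgue_integral_def using eq[OF B(1)]
      by (simp add: ind cong: Bochner_Integration.integral_cong)
  qed
qed

text \<open>Conditional Jensen for the square.\<close>

lemma (in prob_space) integrable_real_cond_exp_vimage_square:
  fixes Z :: "'a \<Rightarrow> real"
  assumes [measurable]: "V \<in> M \<rightarrow>\<^sub>M borel"
    and Z: "integrable M Z" "integrable M (\<lambda>\<omega>. (Z \<omega>)\<^sup>2)"
  shows "integrable M (\<lambda>\<omega>. (real_cond_exp M (vimage_algebra (space M) V borel) Z \<omega>)\<^sup>2)"
proof -
  let ?F = "vimage_algebra (space M) V borel"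
  have sub: "subalgebra M ?F"
    unfolding subalgebra_def
    by (auto simp: sets_vimage_algebra2 intro!: measurable_sets[of V M borel])
  interpret finite_measure_subalgebra M ?F
    by unfold_locales (rule sub)
  show ?thesis
    by (rule integrable_convex_cond_exp[OF Z(1), where I=UNIV and q="\<lambda>x. x\<^sup>2"])
       (use Z(2) convex_power2 in auto)
qed

text \<open>\<open>tilt t x (sqrt t *\<^sub>R u)\<close> is the density at \<open>u\<close> of the law of \<open>sqrt t *\<^sub>R x + Z\<close>, \<open>Z\<close> standard Gaussian,
  relative to that of \<open>Z\<close>; hence \<open>tilt_norm\<close> is the output density and \<open>tilt_mean\<close> the posterior mean.
  At a point that is not of the form \<open>sqrt t *\<^sub>R u\<close> (only possible for \<open>t = 0\<close>) the integrals may diverge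
  and take the junk value \<open>0\<close>.\<close>

definition tilt :: "real \<Rightarrow> 'a::euclidean_space \<Rightarrow> 'a \<Rightarrow> real" where
  "tilt t x y = exp (x \<bullet> y - t / 2 * (norm x)\<^sup>2)"

definition tilt_norm :: "'a::euclidean_space measure \<Rightarrow> real \<Rightarrow> 'a \<Rightarrow> real" where
  "tilt_norm \<mu> t y = (\<integral>x. tilt t x y \<partial>\<mu>)"

definition tilt_mean :: "'a::euclidean_space measure \<Rightarrow> real \<Rightarrow> 'a \<Rightarrow> 'a" where
  "tilt_mean \<mu> t y = (1 / tilt_norm \<mu> t y) *\<^sub>R (\<integral>x. tilt t x y *\<^sub>R x \<partial>\<mu>)"

lemma tilt_pos [simp]: "0 < tilt t x y" and tilt_nonneg [simp]: "0 \<le> tilt t x y"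
  by (simp_all add: tilt_def)

lemma borel_measurable_tilt [measurable (raw)]:
  assumes [measurable]: "f \<in> borel_measurable M" "g \<in> borel_measurable M"
  shows "(\<lambda>x. tilt t (f x) (g x)) \<in> borel_measurable M"
  unfolding tilt_def by measurable

text \<open>Completing the square. The bound is uniform in \<open>x\<close>, so every integral of
  \<open>tilt\<close> over the prior converges without further moment assumptions; this is why the
  second argument has the form \<open>sqrt t *\<^sub>R u\<close>.\<close>

lemma tilt_le:
  assumes "0 \<le> t"
  shows "tilt t x (sqrt t *\<^sub>R u) \<le> exp ((norm u)\<^sup>2 / 2)"
proof -
  have "0 \<le> (norm (sqrt t *\<^sub>R x - u))\<^sup>2" by simp
  also have "\<dots> = t * (norm x)\<^sup>2 - 2 * (x \<bullet> sqrt t *\<^sub>R u) + (norm u)\<^sup>2"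
    unfolding power2_norm_eq_inner using assms
    by (simp add: inner_diff_left inner_diff_right inner_commute algebra_simps)
  finally show ?thesis
    by (simp add: tilt_def)
qed

lemma sets_chan_space: "sets \<mu> = sets borel \<Longrightarrow> sets (chan_space \<mu>) = sets (borel \<Otimes>\<^sub>M borel)"
  unfolding chan_space_def by (rule sets_pair_measure_cong) simp_all

lemma measurable_chan_out [measurable]: "chan_out s \<in> borel \<Otimes>\<^sub>M borel \<rightarrow>\<^sub>M borel"
  unfolding chan_out_def by measurable

locale square_integrable_prior = prob_space \<mu> for \<mu> :: "'a::euclidean_space measure" +
  assumes sets_prior [measurable_cong]: "sets \<mu> = sets borel"
    and integrable_norm2: "integrable \<mu> (\<lambda>x. (norm x)\<^sup>2)"
begin

section \<open>The likelihood averaged over the prior\<close>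

lemma space_prior [simp]: "space \<mu> = UNIV"
  using sets_eq_imp_space_eq[OF sets_prior] by simp

sublocale chan: pair_prob_space \<mu> std_gauss ..

lemma sets_chan [measurable_cong]: "sets (chan_space \<mu>) = sets (borel \<Otimes>\<^sub>M borel)"
  by (rule sets_chan_space[OF sets_prior])

lemma space_chan [simp]: "space (chan_space \<mu>) = UNIV"
  by (simp add: chan_space_def space_pair_measure)

lemma prob_space_chan: "prob_space (chan_space \<mu>)"
  unfolding chan_space_def by (rule chan.P.prob_space_axioms)

lemma nn_integral_chan:
  assumes [measurable]: "g \<in> borel_measurable (borel \<Otimes>\<^sub>M borel)"
  shows "(\<integral>\<^sup>+\<omega>. g \<omega> \<partial>chan_space \<mu>) = (\<integral>\<^sup>+x. \<integral>\<^sup>+u. g (x, u) \<partial>std_gauss \<partial>\<mu>)"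
  unfolding chan_space_def
  by (rule std_gauss.nn_integral_fst[symmetric]) measurable

lemma integrable_norm_prior: "integrable \<mu> (\<lambda>x. norm x)"
proof (rule Bochner_Integration.integrable_bound)
  show "integrable \<mu> (\<lambda>x. 1 + (norm x)\<^sup>2)"
    using integrable_norm2 by (intro Bochner_Integration.integrable_add) auto
  have "norm x \<le> 1 + (norm x)\<^sup>2" for x :: 'a
    using sum_squares_bound[of "norm x" 1] zero_le_power2[of "norm x"]
    unfolding one_power2 mult_1_right by linarith
  then show "AE x in \<mu>. norm (norm x) \<le> norm (1 + (norm x)\<^sup>2)" by simp
qed simp

lemma integrable_tilt: "0 \<le> t \<Longrightarrow> integrable \<mu> (\<lambda>x. tilt t x (sqrt t *\<^sub>R u))"
  by (rule integrable_const_bound[where B="exp ((norm u)\<^sup>2 / 2)"]) (auto simp: tilt_le)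

lemma integrable_tilt_scaleR:
  assumes "0 \<le> t" shows "integrable \<mu> (\<lambda>x. tilt t x (sqrt t *\<^sub>R u) *\<^sub>R x)"
proof (rule Bochner_Integration.integrable_bound)
  show "integrable \<mu> (\<lambda>x. exp ((norm u)\<^sup>2 / 2) * norm x)"
    using integrable_norm_prior by (rule integrable_mult_right)
  show "AE x in \<mu>. norm (tilt t x (sqrt t *\<^sub>R u) *\<^sub>R x) \<le> norm (exp ((norm u)\<^sup>2 / 2) * norm x)"
    using assms by (auto simp: tilt_le intro!: mult_right_mono)
qed measurable

lemma tilt_norm_pos: assumes "0 \<le> t" shows "0 < tilt_norm \<mu> t (sqrt t *\<^sub>R u)"
proof -
  have "0 \<le> tilt_norm \<mu> t (sqrt t *\<^sub>R u)"
    unfolding tilt_norm_def by (rule integral_nonneg_AE) simp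
  moreover have "tilt_norm \<mu> t (sqrt t *\<^sub>R u) \<noteq> 0"
  proof
    assume "tilt_norm \<mu> t (sqrt t *\<^sub>R u) = 0"
    then have "AE x in \<mu>. tilt t x (sqrt t *\<^sub>R u) = 0"
      unfolding tilt_norm_def using integral_nonneg_eq_0_iff_AE[OF integrable_tilt[OF assms]] by auto
    then have "AE x in \<mu>. False" by (rule AE_mp) (auto simp: tilt_def)
    then show False by simp
  qed
  ultimately show ?thesis by simp
qed

lemma tilt_norm_le: assumes "0 \<le> t" shows "tilt_norm \<mu> t (sqrt t *\<^sub>R u) \<le> exp ((norm u)\<^sup>2 / 2)"
proof -
  have "tilt_norm \<mu> t (sqrt t *\<^sub>R u) \<le> (\<integral>x. exp ((norm u)\<^sup>2 / 2) \<partial>\<mu>)"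
    unfolding tilt_norm_def
    by (rule integral_mono[OF integrable_tilt]) (use assms tilt_le in auto)
  then show ?thesis using prob_space by simp
qed

lemma borel_measurable_tilt_norm [measurable]: "tilt_norm \<mu> t \<in> borel_measurable borel"
  unfolding tilt_norm_def[abs_def] by measurable

lemma borel_measurable_tilt_mean [measurable]: "tilt_mean \<mu> t \<in> borel_measurable borel"
  unfolding tilt_mean_def[abs_def] by measurable

lemma tilt_norm_scaleR_tilt_mean:
  "0 \<le> t \<Longrightarrow> tilt_norm \<mu> t (sqrt t *\<^sub>R u) *\<^sub>R tilt_mean \<mu> t (sqrt t *\<^sub>R u)
    = (\<integral>x. tilt t x (sqrt t *\<^sub>R u) *\<^sub>R x \<partial>\<mu>)"
  using tilt_norm_pos[of t u] by (simp add: tilt_mean_def)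

text \<open>Convexity of the log-partition function, whose gradient is the posterior mean;
  by Jensen's inequality no differentiation is needed.\<close>

lemma ln_tilt_norm_convex:
  assumes t: "0 \<le> t"
  shows "ln (tilt_norm \<mu> t (sqrt t *\<^sub>R u)) - ln (tilt_norm \<mu> t (sqrt t *\<^sub>R v))
    \<le> tilt_mean \<mu> t (sqrt t *\<^sub>R u) \<bullet> (sqrt t *\<^sub>R (u - v))"
proof -
  define A where "A = tilt_norm \<mu> t (sqrt t *\<^sub>R u)"
  define m where "m = tilt_mean \<mu> t (sqrt t *\<^sub>R u)"
  define d where "d = sqrt t *\<^sub>R (v - u)"
  have A: "A > 0" by (simp add: A_def tilt_norm_pos t)
  have Am: "(\<integral>x. tilt t x (sqrt t *\<^sub>R u) *\<^sub>R x \<partial>\<mu>) = A *\<^sub>R m"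
    by (simp add: A_def m_def tilt_norm_scaleR_tilt_mean t)
  have int: "integrable \<mu> (\<lambda>x. tilt t x (sqrt t *\<^sub>R u) * (x \<bullet> d))"
    using integrable_inner_left[OF integrable_tilt_scaleR[OF t, of u], of d] by simp
  \<comment> \<open>Passing from \<open>u\<close> to \<open>v\<close> multiplies the likelihood by
    \<open>exp (x \<bullet> d)\<close>, which is bounded below by its tangent at
    \<open>m \<bullet> d\<close>. On integration the linear term disappears, because
    \<open>m\<close> is the mean of the tilted prior.\<close>
  have lb: "exp (m \<bullet> d) * ((1 - m \<bullet> d) * tilt t x (sqrt t *\<^sub>R u) + tilt t x (sqrt t *\<^sub>R u) * (x \<bullet> d))
      \<le> tilt t x (sqrt t *\<^sub>R v)" for x
  proof -
    have "1 + (x \<bullet> d - m \<bullet> d) \<le> exp (x \<bullet> d - m \<bullet> d)" by (rule exp_ge_add_one_self)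
    then have "exp (m \<bullet> d) * tilt t x (sqrt t *\<^sub>R u) * (1 + (x \<bullet> d - m \<bullet> d))
      \<le> exp (m \<bullet> d) * tilt t x (sqrt t *\<^sub>R u) * exp (x \<bullet> d - m \<bullet> d)"
      by (intro mult_left_mono) auto
    also have "\<dots> = tilt t x (sqrt t *\<^sub>R v)"
      by (simp add: tilt_def d_def exp_add[symmetric] inner_diff_right algebra_simps)
    finally show ?thesis by (simp add: algebra_simps)
  qed
  have "exp (m \<bullet> d) * A = (\<integral>x. exp (m \<bullet> d) * ((1 - m \<bullet> d) * tilt t x (sqrt t *\<^sub>R u)
      + tilt t x (sqrt t *\<^sub>R u) * (x \<bullet> d)) \<partial>\<mu>)"
  proof -
    have "(\<integral>x. tilt t x (sqrt t *\<^sub>R u) * (x \<bullet> d) \<partial>\<mu>) = A * (m \<bullet> d)"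
      using integral_inner_left[OF integrable_tilt_scaleR[OF t, of u], of d] by (simp add: Am)
    moreover have "(\<integral>x. tilt t x (sqrt t *\<^sub>R u) \<partial>\<mu>) = A"
      by (simp add: A_def tilt_norm_def)
    ultimately show ?thesis
      using int integrable_tilt[OF t, of u] by (simp add: left_diff_distrib mult.commute[of A])
  qed
  also have "\<dots> \<le> tilt_norm \<mu> t (sqrt t *\<^sub>R v)"
    unfolding tilt_norm_def
    by (rule integral_mono) (use int integrable_tilt[OF t] lb in auto)
  finally have "ln (exp (m \<bullet> d) * A) \<le> ln (tilt_norm \<mu> t (sqrt t *\<^sub>R v))"
    using A by (subst ln_le_cancel_iff) (auto simp: tilt_norm_pos t)
  then have "m \<bullet> d + ln A \<le> ln (tilt_norm \<mu> t (sqrt t *\<^sub>R v))"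
    using A by (simp add: ln_mult)
  moreover have "m \<bullet> d = - (m \<bullet> (sqrt t *\<^sub>R (u - v)))"
    by (simp add: d_def inner_diff_right algebra_simps)
  ultimately show ?thesis by (simp add: A_def m_def)
qed

text \<open>For fixed \<open>x\<close> the output is translated noise, so the likelihood is the
  Cameron-Martin factor. The output law, Bayes' formula and the mutual information are all read off
  from this density.\<close>

lemma distr_chan_joint:
  assumes t: "0 \<le> t"
  shows "distr (chan_space \<mu>) (borel \<Otimes>\<^sub>M borel) (\<lambda>\<omega>. (fst \<omega>, chan_out t \<omega>))
    = density (\<mu> \<Otimes>\<^sub>M std_gauss) (\<lambda>\<omega>. ennreal (tilt t (fst \<omega>) (sqrt t *\<^sub>R snd \<omega>)))" (is "?L = ?R")
proof (rule measure_eqI)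
  show "sets ?L = sets ?R"
    using sets_chan unfolding chan_space_def by (simp only: sets_distr sets_density)
  fix A assume "A \<in> sets ?L"
  then have [measurable]: "A \<in> sets (borel \<Otimes>\<^sub>M borel)" by simp
  have A': "A \<in> sets (\<mu> \<Otimes>\<^sub>M std_gauss)"
    using sets_chan unfolding chan_space_def by simp
  have "emeasure ?L A = (\<integral>\<^sup>+\<omega>. indicator A (fst \<omega>, chan_out t \<omega>) \<partial>chan_space \<mu>)"
    by (simp add: nn_integral_distr flip: nn_integral_indicator)
  also have "\<dots> = (\<integral>\<^sup>+x. \<integral>\<^sup>+u. indicator A (x, sqrt t *\<^sub>R x + u) \<partial>std_gauss \<partial>\<mu>)"
    by (subst nn_integral_chan) (simp_all add: chan_out_def)
  also have "\<dots> = (\<integral>\<^sup>+x. \<integral>\<^sup>+u. indicator A (x, u) * ennreal (tilt t x (sqrt t *\<^sub>R u)) \<partial>std_gauss \<partial>\<mu>)"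
  proof (rule nn_integral_cong)
    fix x :: 'a
    show "(\<integral>\<^sup>+u. indicator A (x, sqrt t *\<^sub>R x + u) \<partial>std_gauss)
        = (\<integral>\<^sup>+u. indicator A (x, u) * ennreal (tilt t x (sqrt t *\<^sub>R u)) \<partial>std_gauss)"
      using t nn_integral_std_gauss_shift[of "\<lambda>u. indicator A (x, u)" "sqrt t *\<^sub>R x"]
      by (simp add: tilt_def power_mult_distrib)
  qed
  also have "\<dots> = (\<integral>\<^sup>+\<omega>. indicator A \<omega> * ennreal (tilt t (fst \<omega>) (sqrt t *\<^sub>R snd \<omega>)) \<partial>(\<mu> \<Otimes>\<^sub>M std_gauss))"
    by (subst std_gauss.nn_integral_fst[symmetric]) simp_all
  also have "\<dots> = emeasure ?R A"
    by (subst emeasure_density) (use A' in \<open>auto simp: mult.commute\<close>)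
  finally show "emeasure ?L A = emeasure ?R A" .
qed

lemma distr_chan_out:
  assumes t: "0 \<le> t"
  shows "distr (chan_space \<mu>) borel (chan_out t)
    = density std_gauss (\<lambda>u. ennreal (tilt_norm \<mu> t (sqrt t *\<^sub>R u)))" (is "?L = ?R")
proof (rule measure_eqI)
  fix A assume "A \<in> sets ?L"
  then have [measurable]: "A \<in> sets borel" by simp
  have "emeasure ?L A = (\<integral>\<^sup>+\<omega>. indicator A (snd (fst \<omega>, chan_out t \<omega>)) \<partial>chan_space \<mu>)"
    by (simp add: nn_integral_distr flip: nn_integral_indicator)
  also have "\<dots> = (\<integral>\<^sup>+\<omega>. indicator A (snd \<omega>) \<partial>distr (chan_space \<mu>) (borel \<Otimes>\<^sub>M borel) (\<lambda>\<omega>. (fst \<omega>, chan_out t \<omega>)))"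
    by (subst nn_integral_distr) simp_all
  also have "\<dots> = (\<integral>\<^sup>+u. \<integral>\<^sup>+x. ennreal (tilt t x (sqrt t *\<^sub>R u)) * indicator A u \<partial>\<mu> \<partial>std_gauss)"
    unfolding distr_chan_joint[OF t]
    by (simp add: nn_integral_density chan.nn_integral_snd[symmetric])
  also have "\<dots> = (\<integral>\<^sup>+u. ennreal (tilt_norm \<mu> t (sqrt t *\<^sub>R u)) * indicator A u \<partial>std_gauss)"
    by (simp add: nn_integral_multc nn_integral_eq_integral integrable_tilt t tilt_norm_def)
  also have "\<dots> = emeasure ?R A"
    by (subst emeasure_density) auto
  finally show "emeasure ?L A = emeasure ?R A" .
qed simp

text \<open>The orthogonality property of the conditional mean, tested against functions of the
  output. It is Bayes' formula: at a fixed output, the likelihood-weighted integral of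
  \<open>x\<close> is the output density times the posterior mean. Assuming only integrability of
  the tested product lets \<open>h\<close> be an indicator as well as a square-integrable
  estimator.\<close>

lemma
  assumes t: "0 \<le> t" and [measurable]: "h \<in> borel_measurable borel"
    and int: "integrable (chan_space \<mu>) (\<lambda>\<omega>. fst \<omega> \<bullet> h (chan_out t \<omega>))"
  shows integrable_posterior_mean_inner:
      "integrable (chan_space \<mu>) (\<lambda>\<omega>. tilt_mean \<mu> t (sqrt t *\<^sub>R chan_out t \<omega>) \<bullet> h (chan_out t \<omega>))"
    and integral_posterior_mean_inner:
      "(\<integral>\<omega>. tilt_mean \<mu> t (sqrt t *\<^sub>R chan_out t \<omega>) \<bullet> h (chan_out t \<omega>) \<partial>chan_space \<mu>)
        = (\<integral>\<omega>. fst \<omega> \<bullet> h (chan_out t \<omega>) \<partial>chan_space \<mu>)"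
proof -
  let ?J = "distr (chan_space \<mu>) (borel \<Otimes>\<^sub>M borel) (\<lambda>\<omega>. (fst \<omega>, chan_out t \<omega>))"
  let ?U = "distr (chan_space \<mu>) borel (chan_out t)"
  let ?e = "\<lambda>x u. tilt t x (sqrt t *\<^sub>R u)"
  let ?r = "\<lambda>u. tilt_norm \<mu> t (sqrt t *\<^sub>R u)"
  let ?m = "\<lambda>u. tilt_mean \<mu> t (sqrt t *\<^sub>R u)"
  have m: "(\<lambda>\<omega>. (fst \<omega>, chan_out t \<omega>)) \<in> chan_space \<mu> \<rightarrow>\<^sub>M borel \<Otimes>\<^sub>M borel" by measurable
  have "integrable ?J (\<lambda>\<omega>. fst \<omega> \<bullet> h (snd \<omega>))"
    by (subst integrable_distr_eq[OF m]) (use int in simp_all)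
  then have i1: "integrable (\<mu> \<Otimes>\<^sub>M std_gauss) (\<lambda>(x, u). ?e x u * (x \<bullet> h u))"
    unfolding distr_chan_joint[OF t] by (subst (asm) integrable_density) (auto simp: split_beta')
  have inner: "(\<integral>x. ?e x u * (x \<bullet> h u) \<partial>\<mu>) = ?r u * (?m u \<bullet> h u)" for u
    using integral_inner_left[OF integrable_tilt_scaleR[OF t, of u], of "h u"]
      tilt_norm_scaleR_tilt_mean[OF t, of u]
    by (metis (mono_tags, lifting) Bochner_Integration.integral_cong inner_scaleR_left)
  have i2: "integrable std_gauss (\<lambda>u. ?r u * (?m u \<bullet> h u))"
    using chan.integrable_snd[OF i1] by (simp add: inner)
  have i3: "integrable ?U (\<lambda>u. ?m u \<bullet> h u)"
    unfolding distr_chan_out[OF t]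
    by (subst integrable_density) (use i2 tilt_norm_pos[OF t] in \<open>auto simp: less_imp_le\<close>)
  then show "integrable (chan_space \<mu>) (\<lambda>\<omega>. ?m (chan_out t \<omega>) \<bullet> h (chan_out t \<omega>))"
    by (subst (asm) integrable_distr_eq) auto
  have "(\<integral>\<omega>. fst \<omega> \<bullet> h (chan_out t \<omega>) \<partial>chan_space \<mu>) = (\<integral>\<omega>. fst \<omega> \<bullet> h (snd \<omega>) \<partial>?J)"
    by (subst integral_distr[OF m]) simp_all
  also have "\<dots> = (\<integral>(x, u). ?e x u * (x \<bullet> h u) \<partial>(\<mu> \<Otimes>\<^sub>M std_gauss))"
    unfolding distr_chan_joint[OF t] by (subst integral_density) (auto simp: split_beta')
  also have "\<dots> = (\<integral>u. ?r u * (?m u \<bullet> h u) \<partial>std_gauss)"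
    using chan.integral_snd[OF i1] by (simp add: inner)
  also have "\<dots> = (\<integral>u. ?m u \<bullet> h u \<partial>?U)"
    unfolding distr_chan_out[OF t]
    by (subst integral_density) (use tilt_norm_pos[OF t] in \<open>auto simp: less_imp_le\<close>)
  also have "\<dots> = (\<integral>\<omega>. ?m (chan_out t \<omega>) \<bullet> h (chan_out t \<omega>) \<partial>chan_space \<mu>)"
    by (subst integral_distr) auto
  finally show "(\<integral>\<omega>. ?m (chan_out t \<omega>) \<bullet> h (chan_out t \<omega>) \<partial>chan_space \<mu>)
        = (\<integral>\<omega>. fst \<omega> \<bullet> h (chan_out t \<omega>) \<partial>chan_space \<mu>)" ..
qed

section \<open>Second moments on the channel space\<close>

lemma distr_chan_fst: "distr (chan_space \<mu>) borel fst = \<mu>"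
proof -
  have "distr (chan_space \<mu>) borel fst = distr (\<mu> \<Otimes>\<^sub>M (std_gauss :: 'a measure)) \<mu> fst"
    unfolding chan_space_def by (rule distr_cong) (simp_all add: sets_prior)
  then show ?thesis by (simp add: std_gauss.distr_pair_fst)
qed

lemma distr_chan_snd: "distr (chan_space \<mu>) borel snd = (std_gauss :: 'a measure)"
proof (rule measure_eqI)
  fix A :: "'a set" assume "A \<in> sets (distr (chan_space \<mu>) borel snd)"
  then have [measurable]: "A \<in> sets borel" by simp
  have "emeasure (distr (chan_space \<mu>) borel snd) A = (\<integral>\<^sup>+\<omega>. indicator A (snd \<omega>) \<partial>chan_space \<mu>)"
    by (subst nn_integral_indicator[symmetric], simp, subst nn_integral_distr) simp_all
  also have "\<dots> = (\<integral>\<^sup>+x. emeasure std_gauss A \<partial>\<mu>)"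
    by (subst nn_integral_chan) simp_all
  also have "\<dots> = emeasure std_gauss A"
    using emeasure_space_1 by simp
  finally show "emeasure (distr (chan_space \<mu>) borel snd) A = emeasure std_gauss A" .
qed simp

lemma integrable_chan_fst_norm2: "integrable (chan_space \<mu>) (\<lambda>\<omega>. (norm (fst \<omega>))\<^sup>2)"
  using integrable_distr_eq[of fst "chan_space \<mu>" borel "\<lambda>x. (norm x)\<^sup>2"] integrable_norm2
  by (simp add: distr_chan_fst)

lemma integral_chan_fst_norm2: "(\<integral>\<omega>. (norm (fst \<omega>))\<^sup>2 \<partial>chan_space \<mu>) = (\<integral>x. (norm x)\<^sup>2 \<partial>\<mu>)"
  using integral_distr[of fst "chan_space \<mu>" borel "\<lambda>x. (norm x)\<^sup>2"]
  by (simp add: distr_chan_fst)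

lemma integrable_chan_snd_norm2: "integrable (chan_space \<mu>) (\<lambda>\<omega>. (norm (snd \<omega>))\<^sup>2)"
  using integrable_distr_eq[of snd "chan_space \<mu>" borel "\<lambda>x. (norm x)\<^sup>2"]
    integrable_std_gauss_norm2[where 'a='a]
  by (simp add: distr_chan_snd)

lemma
  shows integrable_chan_fst_inner_snd: "integrable (chan_space \<mu>) (\<lambda>\<omega>. fst \<omega> \<bullet> snd \<omega>)"
    and integral_chan_fst_inner_snd: "(\<integral>\<omega>. fst \<omega> \<bullet> snd \<omega> \<partial>chan_space \<mu>) = 0"
proof -
  show int: "integrable (chan_space \<mu>) (\<lambda>\<omega>. fst \<omega> \<bullet> snd \<omega>)"
    by (rule integrable_inner_square_integrable)
       (use integrable_chan_fst_norm2 integrable_chan_snd_norm2 in auto)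
  have "(\<integral>\<omega>. fst \<omega> \<bullet> snd \<omega> \<partial>chan_space \<mu>) = (\<integral>x. (\<integral>u. u \<bullet> x \<partial>std_gauss) \<partial>\<mu>)"
    using chan.integral_fst[of "\<lambda>x u. u \<bullet> x"] int by (simp add: chan_space_def split_beta' inner_commute)
  then show "(\<integral>\<omega>. fst \<omega> \<bullet> snd \<omega> \<partial>chan_space \<mu>) = 0"
    by (simp add: integral_std_gauss_inner)
qed

lemma integrable_chan_out_norm2: "integrable (chan_space \<mu>) (\<lambda>\<omega>. (norm (chan_out t \<omega>))\<^sup>2)"
proof -
  have *: "(norm (chan_out t \<omega>))\<^sup>2
      = (sqrt t)\<^sup>2 * (norm (fst \<omega>))\<^sup>2 + 2 * sqrt t * (fst \<omega> \<bullet> snd \<omega>) + (norm (snd \<omega>))\<^sup>2" for \<omega> :: "'a \<times> 'a"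
    unfolding chan_out_def power2_norm_eq_inner
    by (simp add: split_beta inner_add_left inner_add_right inner_commute power2_eq_square algebra_simps)
  show ?thesis
    unfolding * using integrable_chan_fst_norm2 integrable_chan_snd_norm2 integrable_chan_fst_inner_snd
    by auto
qed

lemma integrable_chan_fst_inner: "integrable (chan_space \<mu>) (\<lambda>\<omega>. fst \<omega> \<bullet> b)"
  by (rule integrable_inner_square_integrable)
     (use integrable_chan_fst_norm2 prob_space.emeasure_space_1[OF prob_space_chan] in
      \<open>auto intro!: finite_measure.integrable_const prob_space.finite_measure prob_space_chan\<close>)

lemma real_cond_exp_chan:
  assumes t: "0 \<le> t"
  shows "AE \<omega> in chan_space \<mu>.
    real_cond_exp (chan_space \<mu>) (vimage_algebra (space (chan_space \<mu>)) (chan_out t) borel) (\<lambda>\<omega>'. fst \<omega>' \<bullet> b) \<omega>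
      = tilt_mean \<mu> t (sqrt t *\<^sub>R chan_out t \<omega>) \<bullet> b"
proof (rule prob_space.real_cond_exp_vimage_algebra_eqI[OF prob_space_chan,
      where g="\<lambda>u. tilt_mean \<mu> t (sqrt t *\<^sub>R u) \<bullet> b"])
  show "integrable (chan_space \<mu>) (\<lambda>\<omega>. tilt_mean \<mu> t (sqrt t *\<^sub>R chan_out t \<omega>) \<bullet> b)"
    using integrable_posterior_mean_inner[OF t, of "\<lambda>_. b"] integrable_chan_fst_inner by simp
  fix B :: "'a set" assume [measurable]: "B \<in> sets borel"
  have "integrable (chan_space \<mu>) (\<lambda>\<omega>. indicator (chan_out t -` B) \<omega> *\<^sub>R (fst \<omega> \<bullet> b))"
    by (rule integrable_mult_indicator) (use integrable_chan_fst_inner in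
       \<open>auto intro!: measurable_sets[of "chan_out t" "chan_space \<mu>" borel B, simplified]\<close>)
  then have "integrable (chan_space \<mu>) (\<lambda>\<omega>. fst \<omega> \<bullet> (indicator B (chan_out t \<omega>) *\<^sub>R b))"
    by (simp add: indicator_vimage)
  from integral_posterior_mean_inner[OF t _ this]
  show "(\<integral>\<omega>. indicator B (chan_out t \<omega>) * (fst \<omega> \<bullet> b) \<partial>chan_space \<mu>)
    = (\<integral>\<omega>. indicator B (chan_out t \<omega>) * (tilt_mean \<mu> t (sqrt t *\<^sub>R chan_out t \<omega>) \<bullet> b) \<partial>chan_space \<mu>)"
    by simp
qed (use integrable_chan_fst_inner in auto)

section \<open>Energy of the posterior mean and the MMSE\<close>

definition mean_energy :: "real \<Rightarrow> real" where
  "mean_energy t = (\<integral>\<omega>. (norm (tilt_mean \<mu> t (sqrt t *\<^sub>R chan_out t \<omega>)))\<^sup>2 \<partial>chan_space \<mu>)"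

definition prior_energy :: real where
  "prior_energy = (\<integral>x. (norm x)\<^sup>2 \<partial>\<mu>)"

text \<open>This has to come from conditional Jensen, coordinate by coordinate: testing the
  posterior mean against itself would already presuppose the integrability in question.\<close>

lemma integrable_posterior_mean_norm2:
  assumes t: "0 \<le> t"
  shows "integrable (chan_space \<mu>) (\<lambda>\<omega>. (norm (tilt_mean \<mu> t (sqrt t *\<^sub>R chan_out t \<omega>)))\<^sup>2)"
proof (rule integrable_norm2_sum_Basis)
  fix b :: 'a assume b: "b \<in> Basis"
  have "integrable (chan_space \<mu>) (\<lambda>\<omega>. (real_cond_exp (chan_space \<mu>)
      (vimage_algebra (space (chan_space \<mu>)) (chan_out t) borel) (\<lambda>\<omega>'. fst \<omega>' \<bullet> b) \<omega>)\<^sup>2)"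
    by (rule prob_space.integrable_real_cond_exp_vimage_square[OF prob_space_chan])
       (use integrable_chan_fst_inner integrable_inner_Basis_square[OF _ integrable_chan_fst_norm2 b] in auto)
  then show "integrable (chan_space \<mu>) (\<lambda>\<omega>. (tilt_mean \<mu> t (sqrt t *\<^sub>R chan_out t \<omega>) \<bullet> b)\<^sup>2)"
    by (rule integrable_cong_AE_imp) (use real_cond_exp_chan[OF t, of b] in \<open>auto elim: eventually_mono\<close>)
qed

text \<open>Orthogonality with the posterior mean itself as test function; it turns the mean square
  error into a difference of two energies.\<close>

lemma
  assumes t: "0 \<le> t"
  shows integrable_fst_inner_posterior_mean:
      "integrable (chan_space \<mu>) (\<lambda>\<omega>. fst \<omega> \<bullet> tilt_mean \<mu> t (sqrt t *\<^sub>R chan_out t \<omega>))"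
    and integral_fst_inner_posterior_mean:
      "(\<integral>\<omega>. fst \<omega> \<bullet> tilt_mean \<mu> t (sqrt t *\<^sub>R chan_out t \<omega>) \<partial>chan_space \<mu>) = mean_energy t"
proof -
  show int: "integrable (chan_space \<mu>) (\<lambda>\<omega>. fst \<omega> \<bullet> tilt_mean \<mu> t (sqrt t *\<^sub>R chan_out t \<omega>))"
    by (rule integrable_inner_square_integrable)
       (use integrable_chan_fst_norm2 integrable_posterior_mean_norm2[OF t] in auto)
  show "(\<integral>\<omega>. fst \<omega> \<bullet> tilt_mean \<mu> t (sqrt t *\<^sub>R chan_out t \<omega>) \<partial>chan_space \<mu>) = mean_energy t"
    using integral_posterior_mean_inner[OF t _ int] by (simp add: mean_energy_def power2_norm_eq_inner)
qed

lemma
  assumes t: "0 \<le> t"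
  shows integrable_posterior_error:
      "integrable (chan_space \<mu>) (\<lambda>\<omega>. (norm (fst \<omega> - tilt_mean \<mu> t (sqrt t *\<^sub>R chan_out t \<omega>)))\<^sup>2)"
    and integral_posterior_error:
      "(\<integral>\<omega>. (norm (fst \<omega> - tilt_mean \<mu> t (sqrt t *\<^sub>R chan_out t \<omega>)))\<^sup>2 \<partial>chan_space \<mu>)
        = prior_energy - mean_energy t"
  unfolding power2_norm_diff
  using integrable_chan_fst_norm2 integrable_posterior_mean_norm2[OF t]
    integrable_fst_inner_posterior_mean[OF t] integral_fst_inner_posterior_mean[OF t]
  by (auto simp: prior_energy_def mean_energy_def integral_chan_fst_norm2)

lemma mmse_eq:
  assumes t: "0 \<le> t"
  shows "mmse \<mu> t = prior_energy - mean_energy t"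
proof -
  let ?m = "\<lambda>\<omega>. tilt_mean \<mu> t (sqrt t *\<^sub>R chan_out t \<omega>)"
  have "mmse \<mu> t = (\<Sum>b\<in>Basis. \<integral>\<omega>. ((fst \<omega> - ?m \<omega>) \<bullet> b)\<^sup>2 \<partial>chan_space \<mu>)"
    unfolding mmse_def
  proof (intro sum.cong refl integral_cong_AE)
    fix b :: 'a
    show "AE \<omega> in chan_space \<mu>. (fst \<omega> \<bullet> b - real_cond_exp (chan_space \<mu>)
        (vimage_algebra (space (chan_space \<mu>)) (chan_out t) borel) (\<lambda>\<omega>'. fst \<omega>' \<bullet> b) \<omega>)\<^sup>2
      = ((fst \<omega> - ?m \<omega>) \<bullet> b)\<^sup>2"
      using real_cond_exp_chan[OF t, of b] by (auto simp: inner_diff_left elim: eventually_mono)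
  qed measurable
  also have "\<dots> = (\<integral>\<omega>. (\<Sum>b\<in>Basis. ((fst \<omega> - ?m \<omega>) \<bullet> b)\<^sup>2) \<partial>chan_space \<mu>)"
    by (rule Bochner_Integration.integral_sum[symmetric])
       (rule integrable_inner_Basis_square[OF _ integrable_posterior_error[OF t]], auto)
  also have "\<dots> = prior_energy - mean_energy t"
    unfolding power2_norm_eq_sum[symmetric] by (rule integral_posterior_error[OF t])
  finally show ?thesis .
qed

text \<open>The excess error of \<open>h\<close> is the mean of the squared distance between
  \<open>h\<close> and the posterior mean. With a nonnegative integral on the right,
  \<open>h\<close> needs only measurability: an infinite error makes the claim trivial, and a finite
  one forces \<open>h\<close> to be square integrable.\<close>

lemma posterior_mean_best_approximation:
  assumes t: "0 \<le> t" and [measurable]: "h \<in> borel_measurable borel"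
  shows "ennreal (prior_energy - mean_energy t)
    \<le> (\<integral>\<^sup>+\<omega>. ennreal ((norm (fst \<omega> - h (chan_out t \<omega>)))\<^sup>2) \<partial>chan_space \<mu>)" (is "_ \<le> ?R")
proof (cases "?R = \<infinity>")
  case False
  let ?m = "\<lambda>\<omega>. tilt_mean \<mu> t (sqrt t *\<^sub>R chan_out t \<omega>)"
  let ?h = "\<lambda>\<omega>. h (chan_out t \<omega>)"
  have err: "integrable (chan_space \<mu>) (\<lambda>\<omega>. (norm (fst \<omega> - ?h \<omega>))\<^sup>2)"
    using False by (intro integrableI_bounded) (auto simp: top.not_eq_extremum)
  have h2: "integrable (chan_space \<mu>) (\<lambda>\<omega>. (norm (?h \<omega>))\<^sup>2)"
  proof (rule Bochner_Integration.integrable_bound)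
    show "integrable (chan_space \<mu>) (\<lambda>\<omega>. 2 * (norm (fst \<omega>))\<^sup>2 + 2 * (norm (fst \<omega> - ?h \<omega>))\<^sup>2)"
      using err integrable_chan_fst_norm2 by auto
    have "(norm y)\<^sup>2 \<le> 2 * (norm x)\<^sup>2 + 2 * (norm (x - y))\<^sup>2" for x y :: 'a
    proof -
      have "0 \<le> (norm (2 *\<^sub>R x - y))\<^sup>2" by simp
      then show ?thesis by (simp add: power2_norm_diff power_mult_distrib)
    qed
    then show "AE \<omega> in chan_space \<mu>. norm ((norm (?h \<omega>))\<^sup>2)
      \<le> norm (2 * (norm (fst \<omega>))\<^sup>2 + 2 * (norm (fst \<omega> - ?h \<omega>))\<^sup>2)" by simp
  qed measurable
  have Xh: "integrable (chan_space \<mu>) (\<lambda>\<omega>. fst \<omega> \<bullet> ?h \<omega>)"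
    by (rule integrable_inner_square_integrable) (use integrable_chan_fst_norm2 h2 in auto)
  note mh = integrable_posterior_mean_inner[OF t _ Xh] integral_posterior_mean_inner[OF t _ Xh]
  have "0 \<le> (\<integral>\<omega>. (norm (?m \<omega> - ?h \<omega>))\<^sup>2 \<partial>chan_space \<mu>)" by simp
  also have "\<dots> = mean_energy t - 2 * (\<integral>\<omega>. fst \<omega> \<bullet> ?h \<omega> \<partial>chan_space \<mu>) + (\<integral>\<omega>. (norm (?h \<omega>))\<^sup>2 \<partial>chan_space \<mu>)"
    unfolding power2_norm_diff using mh h2 integrable_posterior_mean_norm2[OF t]
    by (simp add: mean_energy_def)
  also have "\<dots> = (\<integral>\<omega>. (norm (fst \<omega> - ?h \<omega>))\<^sup>2 \<partial>chan_space \<mu>) - (prior_energy - mean_energy t)"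
    unfolding power2_norm_diff using Xh h2 integrable_chan_fst_norm2
    by (simp add: prior_energy_def integral_chan_fst_norm2)
  finally have "prior_energy - mean_energy t \<le> (\<integral>\<omega>. (norm (fst \<omega> - ?h \<omega>))\<^sup>2 \<partial>chan_space \<mu>)" by simp
  then show ?thesis
    by (subst nn_integral_eq_integral[OF err]) (auto intro: ennreal_leI)
qed simp

text \<open>Degrading the channel output at level \<open>t\<close> by independent Gaussian noise gives the output at
  level \<open>s\<close>, so estimating from the former is at least as good.\<close>

lemma mean_energy_mono:
  assumes s: "0 \<le> s" and st: "s \<le> t"
  shows "mean_energy s \<le> mean_energy t"
proof (cases "t = 0")
  case True
  then show ?thesis using assms by simp
next
  case False
  then have t: "0 < t" using assms by simp
  \<comment> \<open>Chosen so that \<open>a\<close> times the output at level \<open>t\<close>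
    carries the signal \<open>sqrt s *\<^sub>R x\<close>, while the fresh noise weighted by
    \<open>c\<close> restores unit variance.\<close>
  define a where "a = sqrt (s / t)"
  define c where "c = sqrt (1 - s / t)"
  have ac: "a\<^sup>2 + c\<^sup>2 = 1" using s st t by (simp add: a_def c_def)
  have a: "a * sqrt t = sqrt s" using t by (simp add: a_def real_sqrt_divide)
  define h where "h u = tilt_mean \<mu> s (sqrt s *\<^sub>R u)" for u
  have [measurable]: "h \<in> borel_measurable borel" unfolding h_def[abs_def] by measurable
  let ?F = "\<lambda>x u. ennreal ((norm (x - h u))\<^sup>2)"
  \<comment> \<open>For each frozen value \<open>z\<close> of the fresh noise, the estimator
    \<open>h\<close> applied to the degraded output competes with the posterior mean at level
    \<open>t\<close>; averaging over \<open>z\<close> keeps the inequality.\<close>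
  have "ennreal (prior_energy - mean_energy t) \<le>
      (\<integral>\<^sup>+z. (\<integral>\<^sup>+\<omega>. ?F (fst \<omega>) (a *\<^sub>R chan_out t \<omega> + c *\<^sub>R z) \<partial>chan_space \<mu>) \<partial>(std_gauss :: 'a measure))"
  proof -
    have "(\<integral>\<^sup>+z. ennreal (prior_energy - mean_energy t) \<partial>(std_gauss :: 'a measure)) \<le>
        (\<integral>\<^sup>+z. (\<integral>\<^sup>+\<omega>. ?F (fst \<omega>) (a *\<^sub>R chan_out t \<omega> + c *\<^sub>R z) \<partial>chan_space \<mu>) \<partial>(std_gauss :: 'a measure))"
    proof (rule nn_integral_mono)
      fix z
      show "ennreal (prior_energy - mean_energy t)
        \<le> (\<integral>\<^sup>+\<omega>. ?F (fst \<omega>) (a *\<^sub>R chan_out t \<omega> + c *\<^sub>R z) \<partial>chan_space \<mu>)"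
        using posterior_mean_best_approximation[of t "\<lambda>u. h (a *\<^sub>R u + c *\<^sub>R z)"] t by simp
    qed
    then show ?thesis by (simp add: std_gauss.emeasure_space_1[simplified])
  qed
  also have "\<dots> = (\<integral>\<^sup>+z. (\<integral>\<^sup>+x. \<integral>\<^sup>+u. ?F x (sqrt s *\<^sub>R x + (a *\<^sub>R u + c *\<^sub>R z)) \<partial>std_gauss \<partial>\<mu>) \<partial>std_gauss)"
    by (subst nn_integral_chan, measurable) (simp add: chan_out_def scaleR_add_right a add.assoc)
  also have "\<dots> = (\<integral>\<^sup>+x. (\<integral>\<^sup>+z. \<integral>\<^sup>+u. ?F x (sqrt s *\<^sub>R x + (a *\<^sub>R u + c *\<^sub>R z)) \<partial>std_gauss \<partial>std_gauss) \<partial>\<mu>)"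
    by (rule chan.Fubini') measurable
  also have "\<dots> = (\<integral>\<^sup>+x. (\<integral>\<^sup>+u. ?F x (sqrt s *\<^sub>R x + u) \<partial>std_gauss) \<partial>\<mu>)"
  proof (rule nn_integral_cong)
    fix x :: 'a
    show "(\<integral>\<^sup>+z. \<integral>\<^sup>+u. ?F x (sqrt s *\<^sub>R x + (a *\<^sub>R u + c *\<^sub>R z)) \<partial>std_gauss \<partial>std_gauss)
      = (\<integral>\<^sup>+u. ?F x (sqrt s *\<^sub>R x + u) \<partial>std_gauss)"
      using nn_integral_std_gauss_rotate[of "\<lambda>u. ?F x (sqrt s *\<^sub>R x + u)" c a] ac
      by (simp add: add.commute)
  qed
  also have "\<dots> = (\<integral>\<^sup>+\<omega>. ?F (fst \<omega>) (chan_out s \<omega>) \<partial>chan_space \<mu>)"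
    by (subst nn_integral_chan, measurable) (simp add: chan_out_def)
  also have "\<dots> = ennreal (prior_energy - mean_energy s)"
    unfolding h_def
    by (subst nn_integral_eq_integral[OF integrable_posterior_error[OF s]])
       (simp_all add: integral_posterior_error[OF s])
  finally have "ennreal (prior_energy - mean_energy t) \<le> ennreal (prior_energy - mean_energy s)" .
  moreover have "0 \<le> prior_energy - mean_energy s"
    unfolding integral_posterior_error[OF s, symmetric] by simp
  ultimately show ?thesis by (simp add: ennreal_le_iff)
qed

end

section \<open>Mutual information\<close>

text \<open>Since \<open>q\<close> is strictly positive, the derivative of one law relative to the
  other is \<open>p / q\<close>. Its uniqueness holds almost everywhere for the second law and
  passes to the first by absolute continuity. Integrability is a hypothesis because
  \<open>KL_div\<close> is infinite without it.\<close>

lemma KL_div_density: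
  fixes p q :: "'b \<Rightarrow> real"
  assumes [measurable]: "p \<in> borel_measurable R" "q \<in> borel_measurable R"
    and p: "\<And>x. 0 \<le> p x" and q: "\<And>x. 0 < q x"
    and sf: "sigma_finite_measure (density R q)"
    and int: "integrable (density R p) (\<lambda>x. ln (p x / q x))"
  shows "KL_div (density R p) (density R q) = ereal (\<integral>x. ln (p x / q x) \<partial>density R p)"
proof -
  let ?P = "density R p" and ?Q = "density R q"
  interpret Q: sigma_finite_measure ?Q by fact
  have P: "density ?Q (\<lambda>x. ennreal (p x / q x)) = ?P"
  proof (subst density_density_eq, simp, simp, rule density_cong)
    show "AE x in R. ennreal (q x) * ennreal (p x / q x) = ennreal (p x)"
      using p q by (simp add: ennreal_mult'[symmetric] less_imp_le less_imp_neq[THEN not_sym])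
  qed simp_all
  have ac: "absolutely_continuous ?Q ?P"
    unfolding P[symmetric] by (rule absolutely_continuousI_density) simp
  have "AE x in ?Q. ennreal (p x / q x) = RN_deriv ?Q ?P x"
    by (rule Q.RN_deriv_unique[OF _ P]) simp
  then have "AE x in ?P. ennreal (p x / q x) = RN_deriv ?Q ?P x"
    by (rule absolutely_continuous_AE[OF _ ac, rotated]) simp
  then have ae: "AE x in ?P. ln (p x / q x) = ln (enn2real (RN_deriv ?Q ?P x))"
    by (rule eventually_mono) (metis enn2real_ennreal divide_nonneg_pos p q)
  have "integrable ?P (\<lambda>x. ln (enn2real (RN_deriv ?Q ?P x)))"
    by (rule integrable_cong_AE_imp[OF int]) (use ae in \<open>auto elim: eventually_mono\<close>)
  moreover have "(\<integral>x. ln (enn2real (RN_deriv ?Q ?P x)) \<partial>?P) = (\<integral>x. ln (p x / q x) \<partial>?P)"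
    by (rule integral_cong_AE) (use ae in \<open>auto elim: eventually_mono\<close>)
  ultimately show ?thesis
    using ac by (simp add: KL_div_def)
qed

text \<open>An increment bound with an error quadratic in the step improves to one without error,
  because the errors vanish along uniform partitions.\<close>

lemma increment_lower_bound_refine:
  fixes F :: "real \<Rightarrow> real"
  assumes ab: "a \<le> b"
    and step: "\<And>v w. a \<le> w \<Longrightarrow> w \<le> v \<Longrightarrow> v \<le> b \<Longrightarrow> A * (v\<^sup>2 - w\<^sup>2) - B * (v - w)\<^sup>2 \<le> F v - F w"
  shows "A * (b\<^sup>2 - a\<^sup>2) \<le> F b - F a"
proof -
  have "A * (b\<^sup>2 - a\<^sup>2) - (F b - F a) \<le> B * (b - a)\<^sup>2 / real m" if m: "m > 0" for m :: nat
  proof -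
    define w where "w j = a + real j * ((b - a) / real m)" for j
    have w0: "w 0 = a" and wm: "w m = b" using m by (simp_all add: w_def)
    have d: "w (Suc j) - w j = (b - a) / real m" for j
      by (simp add: w_def distrib_right add_divide_distrib)
    have wb: "a \<le> w j" "w j \<le> w (Suc j)" "j < m \<Longrightarrow> w (Suc j) \<le> b" for j
    proof -
      show "a \<le> w j" using ab by (simp add: w_def)
      show "w j \<le> w (Suc j)" using d[of j] ab m by (simp add: algebra_simps)
      assume "j < m"
      then have "real (Suc j) * ((b - a) / real m) \<le> real m * ((b - a) / real m)"
        using ab by (intro mult_right_mono) auto
      then show "w (Suc j) \<le> b" using m by (simp add: w_def)
    qed
    \<comment> \<open>Both \<open>F\<close> and the main term telescope, so refinement changes only
      the error: \<open>m\<close> pieces with squared length \<open>((b - a) / m)\<^sup>2\<close>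
      contribute a total of order \<open>1 / m\<close>.\<close>
    have "(\<Sum>j<m. A * ((w (Suc j))\<^sup>2 - (w j)\<^sup>2) - B * ((b - a) / real m)\<^sup>2) \<le> (\<Sum>j<m. F (w (Suc j)) - F (w j))"
    proof (rule sum_mono)
      fix j assume "j \<in> {..<m}"
      then show "A * ((w (Suc j))\<^sup>2 - (w j)\<^sup>2) - B * ((b - a) / real m)\<^sup>2 \<le> F (w (Suc j)) - F (w j)"
        using step[of "w j" "w (Suc j)"] wb[of j] by (simp add: d)
    qed
    moreover have "(\<Sum>j<m. F (w (Suc j)) - F (w j)) = F b - F a"
      using sum_lessThan_telescope[of "\<lambda>j. F (w j)" m] by (simp add: w0 wm)
    moreover have "(\<Sum>j<m. (w (Suc j))\<^sup>2 - (w j)\<^sup>2) = b\<^sup>2 - a\<^sup>2"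
      using sum_lessThan_telescope[of "\<lambda>j. (w j)\<^sup>2" m] by (simp add: w0 wm)
    ultimately have "A * (b\<^sup>2 - a\<^sup>2) - real m * (B * ((b - a) / real m)\<^sup>2) \<le> F b - F a"
      by (simp add: sum_subtractf sum_distrib_left[symmetric])
    moreover have "real m * (B * ((b - a) / real m)\<^sup>2) = B * (b - a)\<^sup>2 / real m"
      using m by (simp add: power2_eq_square)
    ultimately show ?thesis by simp
  qed
  then have "\<exists>M. \<forall>m\<ge>M. A * (b\<^sup>2 - a\<^sup>2) - (F b - F a) \<le> B * (b - a)\<^sup>2 / real m"
    by (intro exI[of _ 1]) simp
  from LIMSEQ_le_const[OF lim_const_over_n this]
  show ?thesis by simp
qed

context square_integrable_prior
begin

text \<open>The level \<open>t\<close> of the density and the level \<open>s\<close> of the output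
  are independent, because Gibbs' inequality and the coupling evaluate the log density of one level
  at the output of another.\<close>

lemma integrable_ln_tilt_norm:
  assumes t: "0 \<le> t"
  shows "integrable (chan_space \<mu>) (\<lambda>\<omega>. ln (tilt_norm \<mu> t (sqrt t *\<^sub>R chan_out s \<omega>)))"
proof -
  interpret C: prob_space "chan_space \<mu>" by (rule prob_space_chan)
  define r where "r v = tilt_norm \<mu> t (sqrt t *\<^sub>R v)" for v
  define m where "m = sqrt t *\<^sub>R tilt_mean \<mu> t (sqrt t *\<^sub>R 0)"
  \<comment> \<open>From above this is the completed square; from below it is the supporting
    hyperplane of the convex function at 0, whose linear term is absorbed by squares.\<close>
  have bound: "\<bar>ln (r v)\<bar> \<le> \<bar>ln (r 0)\<bar> + (norm m)\<^sup>2 + (norm v)\<^sup>2" for v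
  proof -
    have r: "0 < r v" by (simp add: r_def tilt_norm_pos t)
    have "ln (r v) \<le> ln (exp ((norm v)\<^sup>2 / 2))"
      using r tilt_norm_le[OF t, of v] by (subst ln_le_cancel_iff) (auto simp: r_def)
    then have up: "ln (r v) \<le> (norm v)\<^sup>2 / 2" by simp
    have "ln (r 0) - ln (r v) \<le> - (m \<bullet> v)"
      using ln_tilt_norm_convex[OF t, of 0 v] by (simp add: r_def m_def)
    moreover have "\<bar>m \<bullet> v\<bar> \<le> norm m * norm v" by (rule Cauchy_Schwarz_ineq2)
    moreover have "norm m * norm v \<le> (norm m)\<^sup>2 + (norm v)\<^sup>2"
      using sum_squares_bound[of "norm m" "norm v"] zero_le_power2[of "norm m"] zero_le_power2[of "norm v"]
      by linarith
    ultimately show ?thesis using up zero_le_power2[of "norm m"] zero_le_power2[of "norm v"] by linarith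
  qed
  have "integrable (chan_space \<mu>) (\<lambda>\<omega>. ln (r (chan_out s \<omega>)))"
  proof (rule Bochner_Integration.integrable_bound)
    show "integrable (chan_space \<mu>) (\<lambda>\<omega>. \<bar>ln (r 0)\<bar> + (norm m)\<^sup>2 + (norm (chan_out s \<omega>))\<^sup>2)"
      using integrable_chan_out_norm2 by auto
    show "AE \<omega> in chan_space \<mu>. norm (ln (r (chan_out s \<omega>)))
        \<le> norm (\<bar>ln (r 0)\<bar> + (norm m)\<^sup>2 + (norm (chan_out s \<omega>))\<^sup>2)"
      using bound by (auto intro!: order_trans[OF bound])
  qed (simp add: r_def)
  then show ?thesis by (simp add: r_def)
qed

definition log_norm_energy :: "real \<Rightarrow> real" where
  "log_norm_energy t = (\<integral>\<omega>. ln (tilt_norm \<mu> t (sqrt t *\<^sub>R chan_out t \<omega>)) \<partial>chan_space \<mu>)"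

definition info :: "real \<Rightarrow> real" where
  "info t = t / 2 * prior_energy - log_norm_energy t"

lemma mutual_info_eq:
  assumes t: "0 \<le> t"
  shows "mutual_info \<mu> t = ereal (info t)"
proof -
  let ?r = "\<lambda>u. tilt_norm \<mu> t (sqrt t *\<^sub>R u)"
  let ?R = "\<mu> \<Otimes>\<^sub>M (std_gauss :: 'a measure)"
  let ?p = "\<lambda>\<omega>. tilt t (fst \<omega>) (sqrt t *\<^sub>R snd \<omega>)"
  let ?J = "distr (chan_space \<mu>) (borel \<Otimes>\<^sub>M borel) (\<lambda>\<omega>. (fst \<omega>, chan_out t \<omega>))"
  let ?U = "distr (chan_space \<mu>) borel (chan_out t)"
  have m: "(\<lambda>\<omega>. (fst \<omega>, chan_out t \<omega>)) \<in> chan_space \<mu> \<rightarrow>\<^sub>M borel \<Otimes>\<^sub>M borel" by measurable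
  interpret C: prob_space "chan_space \<mu>" by (rule prob_space_chan)
  interpret U: prob_space ?U by (rule C.prob_space_distr) simp
  interpret MU: pair_prob_space \<mu> ?U ..
  have Q: "\<mu> \<Otimes>\<^sub>M ?U = density ?R (\<lambda>\<omega>. ennreal (?r (snd \<omega>)))"
  proof -
    have "density \<mu> (\<lambda>_. 1) \<Otimes>\<^sub>M density std_gauss (\<lambda>u. ennreal (?r u))
        = density ?R (\<lambda>(x, u). 1 * ennreal (?r u))"
      by (rule pair_measure_density)
         (use U.sigma_finite_measure_axioms in \<open>auto simp: distr_chan_out[OF t] std_gauss.sigma_finite_measure_axioms\<close>)
    then show ?thesis
      by (simp add: density_1 distr_chan_out[OF t] split_beta')
  qed
  \<comment> \<open>At the output \<open>sqrt t *\<^sub>R x + z\<close> the exponent of the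
    likelihood gains \<open>t\<close> times the squared norm of the signal, of which half is
    subtracted again, and a signal-noise cross term of mean zero.\<close>
  have ln_eq: "ln (?p (fst \<omega>, chan_out t \<omega>) / ?r (snd (fst \<omega>, chan_out t \<omega>)))
     = t / 2 * (norm (fst \<omega>))\<^sup>2 + sqrt t * (fst \<omega> \<bullet> snd \<omega>) - ln (?r (chan_out t \<omega>))" for \<omega>
  proof -
    have "ln (?p (fst \<omega>, chan_out t \<omega>) / ?r (chan_out t \<omega>))
        = fst \<omega> \<bullet> (sqrt t *\<^sub>R chan_out t \<omega>) - t / 2 * (norm (fst \<omega>))\<^sup>2 - ln (?r (chan_out t \<omega>))"
      using tilt_norm_pos[OF t, of "chan_out t \<omega>"] by (simp add: ln_div) (simp add: tilt_def)
    also have "fst \<omega> \<bullet> (sqrt t *\<^sub>R chan_out t \<omega>) = t * (norm (fst \<omega>))\<^sup>2 + sqrt t * (fst \<omega> \<bullet> snd \<omega>)"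
      unfolding power2_norm_eq_inner using t
      by (simp add: chan_out_def split_beta inner_add_right algebra_simps)
    finally show ?thesis by simp
  qed
  have intC: "integrable (chan_space \<mu>) (\<lambda>\<omega>. t / 2 * (norm (fst \<omega>))\<^sup>2 + sqrt t * (fst \<omega> \<bullet> snd \<omega>) - ln (?r (chan_out t \<omega>)))"
    using integrable_chan_fst_norm2 integrable_chan_fst_inner_snd integrable_ln_tilt_norm[OF t] by auto
  have mln: "(\<lambda>\<omega>. ln (?p \<omega> / ?r (snd \<omega>))) \<in> borel_measurable (borel \<Otimes>\<^sub>M borel)" by measurable
  have intJ: "integrable ?J (\<lambda>\<omega>. ln (?p \<omega> / ?r (snd \<omega>)))"
    by (subst integrable_distr_eq[OF m mln], subst ln_eq) (rule intC)
  have "mutual_info \<mu> t = KL_div (density ?R ?p) (density ?R (\<lambda>\<omega>. ?r (snd \<omega>)))"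
    unfolding mutual_info_def Q distr_chan_joint[OF t] ..
  also have "\<dots> = ereal (\<integral>\<omega>. ln (?p \<omega> / ?r (snd \<omega>)) \<partial>density ?R ?p)"
    by (rule KL_div_density)
       (use MU.P.sigma_finite_measure_axioms intJ tilt_norm_pos[OF t] in \<open>auto simp: Q distr_chan_joint[OF t]\<close>)
  also have "(\<integral>\<omega>. ln (?p \<omega> / ?r (snd \<omega>)) \<partial>density ?R ?p) = (\<integral>\<omega>. ln (?p \<omega> / ?r (snd \<omega>)) \<partial>?J)"
    unfolding distr_chan_joint[OF t] ..
  also have "\<dots> = (\<integral>\<omega>. t / 2 * (norm (fst \<omega>))\<^sup>2 + sqrt t * (fst \<omega> \<bullet> snd \<omega>) - ln (?r (chan_out t \<omega>)) \<partial>chan_space \<mu>)"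
    by (subst integral_distr[OF m mln], subst ln_eq) (rule refl)
  also have "\<dots> = info t"
    using integrable_chan_fst_norm2 integrable_chan_fst_inner_snd integrable_ln_tilt_norm[OF t]
    by (simp add: integral_chan_fst_inner_snd integral_chan_fst_norm2 info_def log_norm_energy_def prior_energy_def)
  finally show ?thesis .
qed

lemma
  assumes t: "0 \<le> t"
  shows integrable_std_gauss_tilt_norm: "integrable std_gauss (\<lambda>u. tilt_norm \<mu> t (sqrt t *\<^sub>R u))"
    and integral_std_gauss_tilt_norm: "(\<integral>u. tilt_norm \<mu> t (sqrt t *\<^sub>R u) \<partial>std_gauss) = 1"
proof -
  let ?r = "\<lambda>u. tilt_norm \<mu> t (sqrt t *\<^sub>R u)"
  interpret C: prob_space "chan_space \<mu>" by (rule prob_space_chan)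
  interpret U: prob_space "distr (chan_space \<mu>) borel (chan_out t)" by (rule C.prob_space_distr) simp
  have 1: "(\<integral>\<^sup>+u. ennreal (?r u) \<partial>std_gauss) = 1"
    using U.emeasure_space_1 unfolding distr_chan_out[OF t] by (simp add: emeasure_density)
  show i: "integrable std_gauss ?r"
    using 1 tilt_norm_pos[OF t] by (intro integrableI_bounded) (auto simp: less_imp_le)
  have "ennreal (\<integral>u. ?r u \<partial>std_gauss) = 1"
    using nn_integral_eq_integral[OF i] 1 tilt_norm_pos[OF t] by (auto simp: less_imp_le)
  then show "(\<integral>u. ?r u \<partial>std_gauss) = 1" by simp
qed

text \<open>Gibbs' inequality for the output laws at the levels \<open>s\<close> and \<open>t\<close>.\<close>

lemma log_norm_energy_ge:
  assumes s: "0 \<le> s" and t: "0 \<le> t"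
  shows "(\<integral>\<omega>. ln (tilt_norm \<mu> t (sqrt t *\<^sub>R chan_out s \<omega>)) \<partial>chan_space \<mu>) \<le> log_norm_energy s"
proof -
  let ?r = "\<lambda>t u. tilt_norm \<mu> t (sqrt t *\<^sub>R u)"
  let ?U = "distr (chan_space \<mu>) borel (chan_out s)"
  interpret C: prob_space "chan_space \<mu>" by (rule prob_space_chan)
  have rs: "?r s u * (?r t u / ?r s u) = ?r t u" for u
    using tilt_norm_pos[OF s, of u] by simp
  have "integrable ?U (\<lambda>u. ?r t u / ?r s u)"
    unfolding distr_chan_out[OF s]
    by (subst integrable_density) (use tilt_norm_pos[OF s] integrable_std_gauss_tilt_norm[OF t] in
      \<open>auto simp: rs less_imp_le simp del: times_divide_eq_right\<close>)
  then have i: "integrable (chan_space \<mu>) (\<lambda>\<omega>. ?r t (chan_out s \<omega>) / ?r s (chan_out s \<omega>))"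
    by (subst (asm) integrable_distr_eq) auto
  \<comment> \<open>Under the output law at level \<open>s\<close> the likelihood ratio has mean
    equal to the total mass of the output law at level \<open>t\<close>.\<close>
  have "(\<integral>\<omega>. ?r t (chan_out s \<omega>) / ?r s (chan_out s \<omega>) \<partial>chan_space \<mu>) = (\<integral>u. ?r t u / ?r s u \<partial>?U)"
    by (subst integral_distr) auto
  also have "\<dots> = 1"
    unfolding distr_chan_out[OF s]
    by (subst integral_density) (use tilt_norm_pos[OF s] integral_std_gauss_tilt_norm[OF t] in
      \<open>auto simp: rs less_imp_le simp del: times_divide_eq_right\<close>)
  finally have one: "(\<integral>\<omega>. ?r t (chan_out s \<omega>) / ?r s (chan_out s \<omega>) \<partial>chan_space \<mu>) = 1" .
  have "(\<integral>\<omega>. ln (?r t (chan_out s \<omega>)) \<partial>chan_space \<mu>)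
      \<le> (\<integral>\<omega>. ln (?r s (chan_out s \<omega>)) + (?r t (chan_out s \<omega>) / ?r s (chan_out s \<omega>) - 1) \<partial>chan_space \<mu>)"
  proof (rule integral_mono)
    fix \<omega> :: "'a \<times> 'a"
    let ?u = "chan_out s \<omega>"
    have "ln (?r t ?u / ?r s ?u) \<le> ?r t ?u / ?r s ?u - 1"
      using tilt_norm_pos[OF s, of ?u] tilt_norm_pos[OF t, of ?u] by (intro ln_le_minus_one) auto
    then show "ln (?r t ?u) \<le> ln (?r s ?u) + (?r t ?u / ?r s ?u - 1)"
      using tilt_norm_pos[OF s, of ?u] tilt_norm_pos[OF t, of ?u] by (simp add: ln_div)
  qed (use i integrable_ln_tilt_norm[OF s] integrable_ln_tilt_norm[OF t] in auto)
  also have "\<dots> = log_norm_energy s"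
    using i integrable_ln_tilt_norm[OF s] one C.prob_space by (simp add: log_norm_energy_def)
  finally show ?thesis .
qed

text \<open>Coupling the outputs at both levels through the same noise makes the linear term of the
  convexity bound proportional to the signal.\<close>

lemma log_norm_energy_increment:
  assumes s: "0 \<le> s" and t: "0 \<le> t"
  shows "log_norm_energy t - log_norm_energy s \<le> sqrt t * (sqrt t - sqrt s) * mean_energy t"
proof -
  let ?r = "\<lambda>u. tilt_norm \<mu> t (sqrt t *\<^sub>R u)"
  let ?m = "\<lambda>u. tilt_mean \<mu> t (sqrt t *\<^sub>R u)"
  have "log_norm_energy t - log_norm_energy s
      \<le> log_norm_energy t - (\<integral>\<omega>. ln (?r (chan_out s \<omega>)) \<partial>chan_space \<mu>)"
    using log_norm_energy_ge[OF s t] by simp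
  also have "\<dots> = (\<integral>\<omega>. ln (?r (chan_out t \<omega>)) - ln (?r (chan_out s \<omega>)) \<partial>chan_space \<mu>)"
    unfolding log_norm_energy_def
    by (rule Bochner_Integration.integral_diff[symmetric]) (rule integrable_ln_tilt_norm[OF t])+
  also have "\<dots> \<le> (\<integral>\<omega>. (sqrt t * (sqrt t - sqrt s)) * (fst \<omega> \<bullet> ?m (chan_out t \<omega>)) \<partial>chan_space \<mu>)"
  proof (rule integral_mono)
    fix \<omega> :: "'a \<times> 'a"
    have d: "chan_out t \<omega> - chan_out s \<omega> = (sqrt t - sqrt s) *\<^sub>R fst \<omega>"
      by (simp add: chan_out_def split_beta scaleR_left_diff_distrib)
    show "ln (?r (chan_out t \<omega>)) - ln (?r (chan_out s \<omega>))
        \<le> (sqrt t * (sqrt t - sqrt s)) * (fst \<omega> \<bullet> ?m (chan_out t \<omega>))"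
      using ln_tilt_norm_convex[OF t, of "chan_out t \<omega>" "chan_out s \<omega>"]
      unfolding d by (simp add: inner_commute mult.assoc)
  qed (use integrable_ln_tilt_norm[OF t] integrable_fst_inner_posterior_mean[OF t] in auto)
  also have "\<dots> = sqrt t * (sqrt t - sqrt s) * mean_energy t"
    by (simp add: integral_fst_inner_posterior_mean[OF t])
  finally show ?thesis .
qed

lemma info_0: "info 0 = 0"
  using prob_space prob_space.prob_space[OF prob_space_chan]
  by (simp add: info_def log_norm_energy_def tilt_norm_def tilt_def)

lemma info_increment:
  assumes s: "0 \<le> s" and st: "s \<le> t"
  shows "(t - s) / 2 * mmse \<mu> t \<le> info t - info s"
proof -
  have t: "0 \<le> t" using assms by simp
  have "mmse \<mu> t / 2 * ((sqrt t)\<^sup>2 - (sqrt s)\<^sup>2) \<le> info ((sqrt t)\<^sup>2) - info ((sqrt s)\<^sup>2)"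
  \<comment> \<open>The error constant comes from \<open>v * (v - w) = (v\<^sup>2 - w\<^sup>2) / 2 +
    (v - w)\<^sup>2 / 2\<close>.\<close>
  proof (rule increment_lower_bound_refine[where B="mean_energy t / 2" and F="\<lambda>w. info (w\<^sup>2)"])
    show "sqrt s \<le> sqrt t" using st by simp
    fix v w assume w: "sqrt s \<le> w" "w \<le> v" "v \<le> sqrt t"
    then have w0: "0 \<le> w" "0 \<le> v" using s real_sqrt_ge_zero[OF s] by linarith+
    have "v\<^sup>2 \<le> (sqrt t)\<^sup>2" using w w0 by (intro power_mono)
    then have vt: "v\<^sup>2 \<le> t" using t by simp
    have "log_norm_energy (v\<^sup>2) - log_norm_energy (w\<^sup>2) \<le> v * (v - w) * mean_energy (v\<^sup>2)"
      using log_norm_energy_increment[of "w\<^sup>2" "v\<^sup>2"] w0 by simp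
    \<comment> \<open>Monotonicity replaces the energy at the right end of a small interval by its
      value at \<open>t\<close>, so the same two constants serve for every piece of the
      partition.\<close>
    also have "\<dots> \<le> v * (v - w) * mean_energy t"
      using mean_energy_mono[OF _ vt] w w0 by (intro mult_left_mono) auto
    finally have "info (v\<^sup>2) - info (w\<^sup>2) \<ge> (v\<^sup>2 - w\<^sup>2) / 2 * prior_energy - v * (v - w) * mean_energy t"
      by (simp add: info_def diff_divide_distrib left_diff_distrib)
    moreover have "(v\<^sup>2 - w\<^sup>2) / 2 * prior_energy - v * (v - w) * mean_energy t
        = mmse \<mu> t / 2 * (v\<^sup>2 - w\<^sup>2) - mean_energy t / 2 * (v - w)\<^sup>2"
      unfolding mmse_eq[OF t] by (simp add: power2_eq_square field_simps)
    ultimately show "mmse \<mu> t / 2 * (v\<^sup>2 - w\<^sup>2) - mean_energy t / 2 * (v - w)\<^sup>2 \<le> info (v\<^sup>2) - info (w\<^sup>2)"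
      by simp
  qed
  then show ?thesis using s t by (simp add: mult.commute)
qed

end

section \<open>Gaussian paths with drift\<close>

declare One_nat_def [simp del]

text \<open>Paths are extensional functions on \<open>{1..n}\<close>, so their value at \<open>0\<close> is junk and is replaced by the
  starting point \<open>0\<close>.\<close>

definition path_at :: "(nat \<Rightarrow> 'a::zero) \<Rightarrow> nat \<Rightarrow> 'a" where
  "path_at y k = (if k = 0 then 0 else y k)"

text \<open>The discrete Girsanov exponent: the stochastic sum of the drift against the path
  increments, minus half of its quadratic variation.\<close>

definition log_lik :: "(nat \<Rightarrow> real) \<Rightarrow> (nat \<Rightarrow> 'a \<Rightarrow> 'a::euclidean_space) \<Rightarrow> nat \<Rightarrow> (nat \<Rightarrow> 'a) \<Rightarrow> real" where
  "log_lik \<delta> f n y = (\<Sum>k=1..n. f k (path_at y (k - 1)) \<bullet> (path_at y k - path_at y (k - 1))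
      - \<delta> k / 2 * (norm (f k (path_at y (k - 1))))\<^sup>2)"

text \<open>The path as a deterministic function of the noise vector. Drift 0 gives the Gaussian
  walk, and a constant drift \<open>x\<close> gives \<open>Y\<close> conditioned on
  \<open>X = x\<close>.\<close>

definition drift_path :: "(nat \<Rightarrow> real) \<Rightarrow> (nat \<Rightarrow> 'a \<Rightarrow> 'a::euclidean_space) \<Rightarrow> nat \<Rightarrow> (nat \<Rightarrow> 'a) \<Rightarrow> nat \<Rightarrow> 'a" where
  "drift_path \<delta> f n v = (\<lambda>k\<in>{1..n}. Zproc \<delta> f (\<lambda>k v. v k) k v)"

abbreviation gauss_noise :: "nat \<Rightarrow> (nat \<Rightarrow> 'a::euclidean_space) measure" where
  "gauss_noise n \<equiv> \<Pi>\<^sub>M k\<in>{1..n}. std_gauss"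

interpretation gauss_noise: product_sigma_finite "\<lambda>k. std_gauss :: 'a::euclidean_space measure"
  by unfold_locales

lemma sets_gauss_noise [measurable_cong]: "sets (gauss_noise n) = sets (\<Pi>\<^sub>M k\<in>{1..n}. borel)"
  by (rule sets_PiM_cong) simp_all

section \<open>The recursions as measurable functions of the noise\<close>

lemma Zproc_cong:
  assumes "\<And>j. j \<in> {1..k} \<Longrightarrow> N j \<omega> = N' j \<omega>'"
  shows "Zproc \<delta> f N k \<omega> = Zproc \<delta> f N' k \<omega>'"
  using assms by (induction k) auto

text \<open>Freezing the signal makes \<open>Y\<close> a process with constant drift, to which the
  Girsanov formula applies.\<close>

lemma Yproc_eq_Zproc: "Yproc \<delta> X N k \<omega> = Zproc \<delta> (\<lambda>_ _. X \<omega>) N k \<omega>"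
  by (induction k) auto

lemma measurable_Zproc:
  fixes f :: "nat \<Rightarrow> 'a::euclidean_space \<Rightarrow> 'a"
  assumes "\<And>j. j \<in> {1..k} \<Longrightarrow> f j \<in> borel_measurable borel"
    and "\<And>j. j \<in> {1..k} \<Longrightarrow> N j \<in> borel_measurable M"
  shows "Zproc \<delta> f N k \<in> borel_measurable M"
  using assms
proof (induction k)
  case 0
  then show ?case by (simp add: measurable_cong[where f="Zproc \<delta> f N 0" and g="\<lambda>_. 0"])
next
  case (Suc k)
  have [measurable]: "Zproc \<delta> f N k \<in> borel_measurable M" by (rule Suc.IH) (use Suc.prems in auto)
  have [measurable]: "f (Suc k) \<in> borel_measurable borel" "N (Suc k) \<in> borel_measurable M"
    using Suc.prems by auto
  have "(\<lambda>\<omega>. Zproc \<delta> f N k \<omega> + \<delta> (Suc k) *\<^sub>R f (Suc k) (Zproc \<delta> f N k \<omega>) + sqrt (\<delta> (Suc k)) *\<^sub>R N (Suc k) \<omega>)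
      \<in> borel_measurable M" by measurable
  then show ?case by (simp cong: measurable_cong)
qed

lemma measurable_Yproc:
  fixes X :: "'b \<Rightarrow> 'a::euclidean_space"
  assumes X [measurable]: "X \<in> borel_measurable M"
    and "\<And>j. j \<in> {1..k} \<Longrightarrow> N j \<in> borel_measurable M"
  shows "Yproc \<delta> X N k \<in> borel_measurable M"
  using assms(2)
proof (induction k)
  case 0
  then show ?case by (simp add: measurable_cong[where f="Yproc \<delta> X N 0" and g="\<lambda>_. 0"])
next
  case (Suc k)
  have [measurable]: "Yproc \<delta> X N k \<in> borel_measurable M" by (rule Suc.IH) (use Suc.prems in auto)
  have [measurable]: "N (Suc k) \<in> borel_measurable M"
    using Suc.prems by auto
  have "(\<lambda>\<omega>. Yproc \<delta> X N k \<omega> + \<delta> (Suc k) *\<^sub>R X \<omega> + sqrt (\<delta> (Suc k)) *\<^sub>R N (Suc k) \<omega>)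
      \<in> borel_measurable M" by measurable
  then show ?case by (simp cong: measurable_cong)
qed

lemma measurable_path_at [measurable]:
  "k \<le> n \<Longrightarrow> (\<lambda>y. path_at y k) \<in> borel_measurable (\<Pi>\<^sub>M k\<in>{1..n}. (borel :: 'a::euclidean_space measure))"
  unfolding path_at_def by (cases "k = 0") simp_all

lemma measurable_log_lik:
  assumes [measurable]: "\<And>j. j \<in> {1..n} \<Longrightarrow> f j \<in> borel_measurable borel"
  shows "log_lik \<delta> f n \<in> borel_measurable (\<Pi>\<^sub>M k\<in>{1..n}. borel)"
proof -
  have "(\<lambda>y. f k (path_at y (k - 1)) \<bullet> (path_at y k - path_at y (k - 1))
      - \<delta> k / 2 * (norm (f k (path_at y (k - 1))))\<^sup>2) \<in> borel_measurable (\<Pi>\<^sub>M k\<in>{1..n}. borel)"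
    if k: "k \<in> {1..n}" for k
  proof -
    have [measurable]: "(\<lambda>y. path_at y k) \<in> borel_measurable (\<Pi>\<^sub>M k\<in>{1..n}. (borel :: 'a measure))"
      "(\<lambda>y. path_at y (k - 1)) \<in> borel_measurable (\<Pi>\<^sub>M k\<in>{1..n}. (borel :: 'a measure))"
      "f k \<in> borel_measurable borel"
      using k by (auto intro: measurable_path_at)
    show ?thesis by measurable
  qed
  then show ?thesis unfolding log_lik_def[abs_def] by measurable
qed

lemma measurable_drift_path:
  assumes "\<And>j. j \<in> {1..n} \<Longrightarrow> f j \<in> borel_measurable borel"
  shows "drift_path \<delta> f n \<in> (\<Pi>\<^sub>M k\<in>{1..n}. borel) \<rightarrow>\<^sub>M (\<Pi>\<^sub>M k\<in>{1..n}. borel)"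
  unfolding drift_path_def[abs_def]
  by (intro measurable_restrict measurable_Zproc) (use assms in auto)

lemma path_at_drift_path: "k \<le> n \<Longrightarrow> path_at (drift_path \<delta> f n v) k = Zproc \<delta> f (\<lambda>k v. v k) k v"
  by (cases k) (simp_all add: path_at_def drift_path_def)

lemma drift_path_Suc:
  "drift_path \<delta> f (Suc n) (v(Suc n := w)) = (drift_path \<delta> f n v)(Suc n :=
     path_at (drift_path \<delta> f n v) n + \<delta> (Suc n) *\<^sub>R f (Suc n) (path_at (drift_path \<delta> f n v) n)
       + sqrt (\<delta> (Suc n)) *\<^sub>R w)" (is "?L = ?R")
proof
  have *: "k \<le> n \<Longrightarrow> Zproc \<delta> f (\<lambda>k v. v k) k (v(Suc n := w)) = Zproc \<delta> f (\<lambda>k v. v k) k v" for k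
    by (rule Zproc_cong) auto
  fix k
  consider "k = Suc n" | "k \<in> {1..n}" | "k \<notin> {1..Suc n}" by fastforce
  then show "?L k = ?R k"
  proof cases
    case 1
    then show ?thesis by (simp add: path_at_drift_path *) (simp add: drift_path_def *)
  next
    case 2
    then show ?thesis by (simp add: drift_path_def *)
  next
    case 3
    then show ?thesis by (auto simp add: drift_path_def)
  qed
qed

lemma log_lik_Suc_upd:
  "log_lik \<delta> f (Suc n) (y(Suc n := z)) = log_lik \<delta> f n y
    + (f (Suc n) (path_at y n) \<bullet> (z - path_at y n) - \<delta> (Suc n) / 2 * (norm (f (Suc n) (path_at y n)))\<^sup>2)"
proof -
  have *: "k \<le> n \<Longrightarrow> path_at (y(Suc n := z)) k = path_at y k" for k
    by (simp add: path_at_def)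
  have "log_lik \<delta> f n (y(Suc n := z)) = log_lik \<delta> f n y"
    unfolding log_lik_def by (rule sum.cong) (auto simp: *)
  then show ?thesis
    by (simp add: log_lik_def *) (simp add: path_at_def)
qed

text \<open>A discrete Girsanov formula: the drift of each step is absorbed by translating its Gaussian noise.\<close>

lemma nn_integral_drift_path:
  fixes f :: "nat \<Rightarrow> 'a::euclidean_space \<Rightarrow> 'a"
  assumes "\<And>j. j \<in> {1..n} \<Longrightarrow> f j \<in> borel_measurable borel"
    and "\<And>j. j \<in> {1..n} \<Longrightarrow> 0 \<le> \<delta> j"
    and "g \<in> borel_measurable (\<Pi>\<^sub>M k\<in>{1..n}. borel)"
  shows "(\<integral>\<^sup>+v. g (drift_path \<delta> f n v) \<partial>gauss_noise n)
    = (\<integral>\<^sup>+v. g (drift_path \<delta> (\<lambda>_ _. 0) n v) * exp (log_lik \<delta> f n (drift_path \<delta> (\<lambda>_ _. 0) n v)) \<partial>gauss_noise n)"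
  using assms
proof (induction n arbitrary: g)
  case 0
  then show ?case by (simp add: drift_path_def log_lik_def)
next
  case (Suc n)
  have [measurable]: "f (Suc n) \<in> borel_measurable borel" and \<delta>: "0 \<le> \<delta> (Suc n)"
    using Suc.prems by auto
  have f [measurable]: "j \<in> {1..n} \<Longrightarrow> f j \<in> borel_measurable borel" for j
    using Suc.prems by auto
  have ins: "{1..Suc n} = insert (Suc n) {1..n}" by auto
  have g [measurable]: "g \<in> borel_measurable (\<Pi>\<^sub>M k\<in>insert (Suc n) {1..n}. borel)"
    using Suc.prems(3) unfolding ins .
  have mf: "drift_path \<delta> f (Suc n) \<in> (\<Pi>\<^sub>M k\<in>insert (Suc n) {1..n}. borel) \<rightarrow>\<^sub>M (\<Pi>\<^sub>M k\<in>insert (Suc n) {1..n}. borel)"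
    unfolding ins[symmetric] by (rule measurable_drift_path) (rule Suc.prems(1))
  have mS: "drift_path \<delta> (\<lambda>_ _. 0 :: 'a) (Suc n)
      \<in> (\<Pi>\<^sub>M k\<in>insert (Suc n) {1..n}. borel) \<rightarrow>\<^sub>M (\<Pi>\<^sub>M k\<in>insert (Suc n) {1..n}. borel)"
    unfolding ins[symmetric] by (rule measurable_drift_path) simp
  have [measurable]: "log_lik \<delta> f (Suc n) \<in> borel_measurable (\<Pi>\<^sub>M k\<in>insert (Suc n) {1..n}. borel)"
    unfolding ins[symmetric] by (rule measurable_log_lik) (rule Suc.prems(1))
  have [measurable]: "(\<lambda>y. path_at y n) \<in> borel_measurable (\<Pi>\<^sub>M k\<in>{1..n}. (borel :: 'a measure))"
    by (rule measurable_path_at) simp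
  have sets_ins [measurable_cong]: "sets (\<Pi>\<^sub>M k\<in>insert (Suc n) {1..n}. std_gauss)
      = sets (\<Pi>\<^sub>M k\<in>insert (Suc n) {1..n}. (borel :: 'a measure))"
    by (rule sets_PiM_cong) simp_all
  \<comment> \<open>The last noise is integrated out, leaving a functional of the first
    \<open>n\<close> points to which the induction hypothesis applies.\<close>
  define H where "H y = (\<integral>\<^sup>+w. g (y(Suc n := path_at y n + \<delta> (Suc n) *\<^sub>R f (Suc n) (path_at y n)
      + sqrt (\<delta> (Suc n)) *\<^sub>R w)) \<partial>std_gauss)" for y
  have upd [measurable]: "(\<lambda>(y, w). y(Suc n := h y w)) \<in> (\<Pi>\<^sub>M k\<in>{1..n}. borel) \<Otimes>\<^sub>M borel \<rightarrow>\<^sub>M (\<Pi>\<^sub>M k\<in>insert (Suc n) {1..n}. borel)"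
    if [measurable]: "(\<lambda>(y, w). h y w) \<in> (\<Pi>\<^sub>M k\<in>{1..n}. borel) \<Otimes>\<^sub>M borel \<rightarrow>\<^sub>M (borel :: 'a measure)"
    for h :: "(nat \<Rightarrow> 'a) \<Rightarrow> 'a \<Rightarrow> 'a"
    unfolding split_beta' by (rule measurable_fun_upd[where J="{1..n}"]) (use that in \<open>auto simp: split_beta'\<close>)
  have H [measurable]: "H \<in> borel_measurable (\<Pi>\<^sub>M k\<in>{1..n}. borel)"
    unfolding H_def[abs_def]
    by (rule std_gauss.borel_measurable_nn_integral)
       (use measurable_compose[OF upd g] in \<open>auto simp: split_beta'\<close>)
  let ?S = "drift_path \<delta> (\<lambda>_ _. 0 :: 'a)"
  have Heq: "H y * exp (log_lik \<delta> f n y) = (\<integral>\<^sup>+w. (let z = y(Suc n := path_at y n + sqrt (\<delta> (Suc n)) *\<^sub>R w)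
      in g z * exp (log_lik \<delta> f (Suc n) z)) \<partial>std_gauss)"
    if y: "y \<in> space (\<Pi>\<^sub>M k\<in>{1..n}. (borel :: 'a measure))" for y
  proof -
    let ?f = "f (Suc n) (path_at y n)" and ?d = "sqrt (\<delta> (Suc n))"
    have [measurable]: "(\<lambda>w. g (y(Suc n := path_at y n + ?d *\<^sub>R w))) \<in> borel_measurable borel"
    proof -
      have "(\<lambda>w. y(Suc n := path_at y n + ?d *\<^sub>R w)) \<in> borel \<rightarrow>\<^sub>M (\<Pi>\<^sub>M k\<in>insert (Suc n) {1..n}. borel)"
        by (rule measurable_fun_upd[where J="{1..n}"]) (use y in auto)
      from measurable_compose[OF this g] show ?thesis .
    qed
    \<comment> \<open>Writing the step size as a square turns the drift into a translation of the
      noise by \<open>sqrt (\<delta> (Suc n)) *\<^sub>R f\<close>. Expressed through the increment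
      of the driftless walk, the Cameron-Martin exponent is then the new summand of
      \<open>log_lik\<close>.\<close>
    have "H y = (\<integral>\<^sup>+w. g (y(Suc n := path_at y n + ?d *\<^sub>R (?d *\<^sub>R ?f + w))) \<partial>std_gauss)"
      unfolding H_def using \<delta> by (simp add: scaleR_add_right add.assoc)
    also have "\<dots> = (\<integral>\<^sup>+w. g (y(Suc n := path_at y n + ?d *\<^sub>R w)) * exp ((?d *\<^sub>R ?f) \<bullet> w - (norm (?d *\<^sub>R ?f))\<^sup>2 / 2) \<partial>std_gauss)"
      by (rule nn_integral_std_gauss_shift) measurable
    finally have "H y * exp (log_lik \<delta> f n y) = (\<integral>\<^sup>+w. g (y(Suc n := path_at y n + ?d *\<^sub>R w))
        * exp ((?d *\<^sub>R ?f) \<bullet> w - (norm (?d *\<^sub>R ?f))\<^sup>2 / 2) * exp (log_lik \<delta> f n y) \<partial>std_gauss)"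
      by (simp add: nn_integral_multc)
    also have "\<dots> = (\<integral>\<^sup>+w. (let z = y(Suc n := path_at y n + ?d *\<^sub>R w)
        in g z * exp (log_lik \<delta> f (Suc n) z)) \<partial>std_gauss)"
      using \<delta> by (intro nn_integral_cong)
        (simp add: log_lik_Suc_upd mult.assoc ennreal_mult'[symmetric] exp_add[symmetric] power_mult_distrib add.commute)
    finally show ?thesis .
  qed
  have gf: "(\<lambda>v. g (drift_path \<delta> f (Suc n) v)) \<in> borel_measurable (\<Pi>\<^sub>M k\<in>insert (Suc n) {1..n}. std_gauss)"
    unfolding measurable_cong_sets[OF sets_ins refl]
    by (rule measurable_compose[OF mf g])
  have gS: "(\<lambda>v. g (?S (Suc n) v) * ennreal (exp (log_lik \<delta> f (Suc n) (?S (Suc n) v))))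
      \<in> borel_measurable (\<Pi>\<^sub>M k\<in>insert (Suc n) {1..n}. std_gauss)"
    unfolding measurable_cong_sets[OF sets_ins refl]
    by (rule measurable_compose[OF mS, where g="\<lambda>y. g y * ennreal (exp (log_lik \<delta> f (Suc n) y))"]) measurable
  have "(\<integral>\<^sup>+v. g (drift_path \<delta> f (Suc n) v) \<partial>gauss_noise (Suc n))
      = (\<integral>\<^sup>+v. \<integral>\<^sup>+w. g (drift_path \<delta> f (Suc n) (v(Suc n := w))) \<partial>std_gauss \<partial>gauss_noise n)"
    unfolding ins by (rule gauss_noise.product_nn_integral_insert[OF _ _ gf]) auto
  also have "\<dots> = (\<integral>\<^sup>+v. H (drift_path \<delta> f n v) \<partial>gauss_noise n)"
    unfolding drift_path_Suc H_def ..
  also have "\<dots> = (\<integral>\<^sup>+v. H (?S n v) * exp (log_lik \<delta> f n (?S n v)) \<partial>gauss_noise n)"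
    by (rule Suc.IH) (use Suc.prems in auto)
  also have "\<dots> = (\<integral>\<^sup>+v. \<integral>\<^sup>+w. g (?S (Suc n) (v(Suc n := w)))
      * exp (log_lik \<delta> f (Suc n) (?S (Suc n) (v(Suc n := w)))) \<partial>std_gauss \<partial>gauss_noise n)"
  proof (rule nn_integral_cong)
    fix v :: "nat \<Rightarrow> 'a"
    have "?S n v \<in> space (\<Pi>\<^sub>M k\<in>{1..n}. (borel :: 'a measure))"
      by (simp add: space_PiM drift_path_def)
    from Heq[OF this] show "H (?S n v) * exp (log_lik \<delta> f n (?S n v))
      = (\<integral>\<^sup>+w. g (?S (Suc n) (v(Suc n := w))) * exp (log_lik \<delta> f (Suc n) (?S (Suc n) (v(Suc n := w)))) \<partial>std_gauss)"
      by (simp add: drift_path_Suc Let_def)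
  qed
  also have "\<dots> = (\<integral>\<^sup>+v. g (?S (Suc n) v) * exp (log_lik \<delta> f (Suc n) (?S (Suc n) v)) \<partial>gauss_noise (Suc n))"
    unfolding ins by (rule gauss_noise.product_nn_integral_insert[OF _ _ gS, symmetric]) auto
  finally show ?case .
qed

lemma nn_integral_gauss_walk:
  fixes g :: "'a::euclidean_space \<Rightarrow> ennreal"
  assumes "\<And>j. j \<in> {1..n} \<Longrightarrow> 0 < \<delta> j" and "g \<in> borel_measurable borel"
  shows "(\<integral>\<^sup>+v. g (Zproc \<delta> (\<lambda>_ _. 0) (\<lambda>k v. v k) n v) \<partial>gauss_noise n)
    = (\<integral>\<^sup>+u. g (sqrt (\<Sum>j=1..n. \<delta> j) *\<^sub>R u) \<partial>std_gauss)"
  using assms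
proof (induction n arbitrary: g)
  case 0
  have "(\<integral>\<^sup>+v. g 0 \<partial>gauss_noise 0) = g 0"
    by (simp add: space_PiM emeasure_PiM_empty)
  moreover have "(\<integral>\<^sup>+u. g 0 \<partial>(std_gauss :: 'a measure)) = g 0"
    using std_gauss.emeasure_space_1[where 'a='a] by simp
  ultimately show ?case by simp
next
  case (Suc n)
  note [measurable] = Suc.prems(2)
  let ?S = "Zproc \<delta> (\<lambda>_ _. 0 :: 'a) (\<lambda>k v. v k)"
  have ins: "{1..Suc n} = insert (Suc n) {1..n}" by auto
  define t d where "t = (\<Sum>j=1..n. \<delta> j)" and "d = \<delta> (Suc n)"
  have t: "0 \<le> t" unfolding t_def using Suc.prems(1) by (intro sum_nonneg) (auto simp: less_imp_le)
  have d: "0 < d" unfolding d_def using Suc.prems(1) by auto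
  have mS: "?S (Suc n) \<in> borel_measurable (\<Pi>\<^sub>M k\<in>insert (Suc n) {1..n}. borel)"
    unfolding ins[symmetric] by (rule measurable_Zproc) auto
  have sets_ins [measurable_cong]: "sets (\<Pi>\<^sub>M k\<in>insert (Suc n) {1..n}. std_gauss)
      = sets (\<Pi>\<^sub>M k\<in>insert (Suc n) {1..n}. (borel :: 'a measure))"
    by (rule sets_PiM_cong) simp_all
  have gS: "(\<lambda>v. g (?S (Suc n) v)) \<in> borel_measurable (\<Pi>\<^sub>M k\<in>insert (Suc n) {1..n}. std_gauss)"
    unfolding measurable_cong_sets[OF sets_ins refl] by (rule measurable_compose[OF mS Suc.prems(2)])
  have *: "?S n (v(Suc n := w)) = ?S n v" for v w
    by (rule Zproc_cong) auto
  have "(\<integral>\<^sup>+v. g (?S (Suc n) v) \<partial>gauss_noise (Suc n))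
      = (\<integral>\<^sup>+v. \<integral>\<^sup>+w. g (?S (Suc n) (v(Suc n := w))) \<partial>std_gauss \<partial>gauss_noise n)"
    unfolding ins by (rule gauss_noise.product_nn_integral_insert[OF _ _ gS]) auto
  also have "\<dots> = (\<integral>\<^sup>+v. \<integral>\<^sup>+w. g (?S n v + sqrt d *\<^sub>R w) \<partial>std_gauss \<partial>gauss_noise n)"
    by (simp add: * d_def)
  also have "\<dots> = (\<integral>\<^sup>+u. \<integral>\<^sup>+w. g (sqrt t *\<^sub>R u + sqrt d *\<^sub>R w) \<partial>std_gauss \<partial>std_gauss)"
    unfolding t_def by (rule Suc.IH) (use Suc.prems in auto)
  \<comment> \<open>Normalised so that the squared coefficients of the two independent vectors sum
    to 1; \<open>t + d\<close> is positive even when no step precedes.\<close>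
  also have "\<dots> = (\<integral>\<^sup>+u. \<integral>\<^sup>+w. g (sqrt (t + d) *\<^sub>R (sqrt (t / (t + d)) *\<^sub>R u + sqrt (d / (t + d)) *\<^sub>R w)) \<partial>std_gauss \<partial>std_gauss)"
    using t d by (simp add: scaleR_add_right real_sqrt_mult[symmetric] del: real_sqrt_mult)
  also have "\<dots> = (\<integral>\<^sup>+u. g (sqrt (t + d) *\<^sub>R u) \<partial>std_gauss)"
    by (rule nn_integral_std_gauss_rotate[where g="\<lambda>u. g (sqrt (t + d) *\<^sub>R u)"])
       (use t d in \<open>auto simp: add_divide_distrib[symmetric]\<close>)
  finally show ?case by (simp add: t_def d_def)
qed

text \<open>Each \<open>N j\<close> is a function of the singleton block \<open>{Some j}\<close>,
  and these blocks are disjoint; grouping by them also changes the index set.\<close>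

lemma (in prob_space) indep_vars_case_option_Some:
  assumes "indep_vars (\<lambda>_. S) (\<lambda>i. case i of None \<Rightarrow> X | Some k \<Rightarrow> N k) (insert None (Some ` I))"
  shows "indep_vars (\<lambda>_. S) N I"
proof -
  have "indep_vars (\<lambda>j. \<Pi>\<^sub>M i\<in>{Some j}. S)
      (\<lambda>j \<omega>. \<lambda>i\<in>{Some j}. (case i of None \<Rightarrow> X | Some k \<Rightarrow> N k) \<omega>) I"
    by (rule indep_vars_restrict[OF assms]) (auto simp: disjoint_family_on_def)
  then have "indep_vars (\<lambda>_. S) (\<lambda>j \<omega>. (\<lambda>v. v (Some j)) (\<lambda>i\<in>{Some j}. (case i of None \<Rightarrow> X | Some k \<Rightarrow> N k) \<omega>)) I"
    by (rule indep_vars_compose2) measurable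
  then show ?thesis by simp
qed

lemma (in prob_space) distr_indep_gauss_noise:
  fixes N :: "nat \<Rightarrow> 'a \<Rightarrow> 'b::euclidean_space"
  assumes n: "1 \<le> n" and ind: "indep_vars (\<lambda>_. borel) N {1..n}"
    and law: "\<And>k. k \<in> {1..n} \<Longrightarrow> distr M borel (N k) = std_gauss"
  shows "distr M (\<Pi>\<^sub>M k\<in>{1..n}. borel) (\<lambda>\<omega>. \<lambda>k\<in>{1..n}. N k \<omega>) = gauss_noise n"
proof -
  have "distr M (\<Pi>\<^sub>M k\<in>{1..n}. borel) (\<lambda>\<omega>. \<lambda>k\<in>{1..n}. N k \<omega>) = (\<Pi>\<^sub>M k\<in>{1..n}. distr M borel (N k))"
    by (subst indep_vars_iff_distr_eq_PiM'[symmetric]) (use n ind in \<open>auto simp: indep_vars_def\<close>)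
  also have "\<dots> = gauss_noise n"
    by (rule PiM_cong) (simp_all add: law)
  finally show ?thesis .
qed

text \<open>The common reference measure: the laws of \<open>Y\<close> and \<open>Z\<close> both
  have strictly positive densities relative to it.\<close>

definition walk_law :: "(nat \<Rightarrow> real) \<Rightarrow> nat \<Rightarrow> (nat \<Rightarrow> 'a::euclidean_space) measure" where
  "walk_law \<delta> n = distr (gauss_noise n) (\<Pi>\<^sub>M k\<in>{1..n}. borel) (drift_path \<delta> (\<lambda>_ _. 0) n)"

lemma measurable_walk [measurable]:
  "drift_path \<delta> (\<lambda>_ _. 0) n \<in> gauss_noise n \<rightarrow>\<^sub>M (\<Pi>\<^sub>M k\<in>{1..n}. (borel :: 'a::euclidean_space measure))"
  unfolding measurable_cong_sets[OF sets_gauss_noise refl] by (rule measurable_drift_path) simp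

lemma sets_walk_law [simp, measurable_cong]: "sets (walk_law \<delta> n) = sets (\<Pi>\<^sub>M k\<in>{1..n}. borel)"
  by (simp add: walk_law_def)

lemma (in prob_space) path_law_Zproc:
  fixes N :: "nat \<Rightarrow> 'a \<Rightarrow> 'b::euclidean_space"
  assumes n: "1 \<le> n" and ind: "indep_vars (\<lambda>_. borel) N {1..n}"
    and law: "\<And>k. k \<in> {1..n} \<Longrightarrow> distr M borel (N k) = std_gauss"
    and f: "\<And>k. k \<in> {1..n} \<Longrightarrow> f k \<in> borel_measurable borel"
    and \<delta>: "\<And>k. k \<in> {1..n} \<Longrightarrow> 0 < \<delta> k"
  shows "path_law M n (Zproc \<delta> f N) = density (walk_law \<delta> n) (\<lambda>y. ennreal (exp (log_lik \<delta> f n y)))"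
    (is "?L = ?R")
proof (rule measure_eqI)
  show "sets ?L = sets ?R" by (simp add: path_law_def)
  fix A assume "A \<in> sets ?L"
  then have A [measurable]: "A \<in> sets (\<Pi>\<^sub>M k\<in>{1..n}. borel)" by (simp add: path_law_def)
  have [measurable]: "log_lik \<delta> f n \<in> borel_measurable (\<Pi>\<^sub>M k\<in>{1..n}. borel)"
    by (rule measurable_log_lik) (rule f)
  have mf [measurable]: "drift_path \<delta> f n \<in> (\<Pi>\<^sub>M k\<in>{1..n}. borel) \<rightarrow>\<^sub>M (\<Pi>\<^sub>M k\<in>{1..n}. borel)"
    by (rule measurable_drift_path) (rule f)
  have N: "k \<in> {1..n} \<Longrightarrow> N k \<in> borel_measurable M" for k
    using ind by (auto simp: indep_vars_def)
  have [measurable]: "(\<lambda>\<omega>. \<lambda>k\<in>{1..n}. N k \<omega>) \<in> M \<rightarrow>\<^sub>M (\<Pi>\<^sub>M k\<in>{1..n}. borel)"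
    by (rule measurable_restrict) (rule N)
  have noise: "distr M (\<Pi>\<^sub>M k\<in>{1..n}. borel) (\<lambda>\<omega>. \<lambda>k\<in>{1..n}. N k \<omega>) = gauss_noise n"
    using n ind law by (rule distr_indep_gauss_noise)
  have path: "(\<lambda>k\<in>{1..n}. Zproc \<delta> f N k \<omega>) = drift_path \<delta> f n (\<lambda>k\<in>{1..n}. N k \<omega>)" for \<omega>
    unfolding drift_path_def by (intro restrict_ext Zproc_cong) auto
  have "emeasure ?L A = (\<integral>\<^sup>+\<omega>. indicator A (drift_path \<delta> f n (\<lambda>k\<in>{1..n}. N k \<omega>)) \<partial>M)"
    unfolding path_law_def path
    by (subst nn_integral_indicator[symmetric], simp, subst nn_integral_distr) simp_all
  also have "\<dots> = (\<integral>\<^sup>+v. indicator A (drift_path \<delta> f n v) \<partial>gauss_noise n)"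
    unfolding noise[symmetric] by (subst nn_integral_distr) simp_all
  also have "\<dots> = (\<integral>\<^sup>+v. indicator A (drift_path \<delta> (\<lambda>_ _. 0) n v)
      * ennreal (exp (log_lik \<delta> f n (drift_path \<delta> (\<lambda>_ _. 0) n v))) \<partial>gauss_noise n)"
    by (rule nn_integral_drift_path) (use f \<delta> in \<open>auto simp: less_imp_le\<close>)
  also have "\<dots> = (\<integral>\<^sup>+y. indicator A y * ennreal (exp (log_lik \<delta> f n y)) \<partial>walk_law \<delta> n)"
    unfolding walk_law_def by (subst nn_integral_distr) simp_all
  also have "\<dots> = emeasure ?R A"
    by (subst emeasure_density) (auto simp: mult.commute)
  finally show "emeasure ?L A = emeasure ?R A" .
qed

section \<open>The divergence of the path laws\<close>

lemma Yproc_cong: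
  assumes "X \<omega> = X' \<omega>'" "\<And>j. j \<in> {1..k} \<Longrightarrow> N j \<omega> = N' j \<omega>'"
  shows "Yproc \<delta> X N k \<omega> = Yproc \<delta> X' N' k \<omega>'"
  using assms(2) by (induction k) (auto simp: assms(1))

text \<open>The steps are arbitrary positive numbers here, since the formula for the divergence
  holds on every grid; the geometric grid enters only in \<open>geometric_grid_bound\<close> and the
  theorem.\<close>

locale noisy_observation = square_integrable_prior \<mu> + M: prob_space M
  for \<mu> :: "'a::euclidean_space measure" and M :: "'b measure" +
  fixes X :: "'b \<Rightarrow> 'a" and N :: "nat \<Rightarrow> 'b \<Rightarrow> 'a" and \<delta> :: "nat \<Rightarrow> real" and n :: nat
  assumes X_meas [measurable]: "X \<in> borel_measurable M" and X_law: "distr M borel X = \<mu>"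
    and N_law: "\<And>k. k \<in> {1..n} \<Longrightarrow> distr M borel (N k) = std_gauss"
    and indep: "M.indep_vars (\<lambda>_. borel) (\<lambda>i. case i of None \<Rightarrow> X | Some k \<Rightarrow> N k)
                  (insert None (Some ` {1..n}))"
    and n_pos: "1 \<le> n" and \<delta>_pos: "\<And>k. k \<in> {1..n} \<Longrightarrow> 0 < \<delta> k"
begin

definition time :: "nat \<Rightarrow> real" where
  "time k = (\<Sum>j=1..k. \<delta> j)"

abbreviation Y :: "nat \<Rightarrow> 'b \<Rightarrow> 'a" where
  "Y \<equiv> Yproc \<delta> X N"

section \<open>Joint laws of signal, noise and observations\<close>

lemma indep_N: "M.indep_vars (\<lambda>_. borel) N {1..n}"
  by (rule M.indep_vars_case_option_Some[OF indep])

lemma N_meas: "k \<in> {1..n} \<Longrightarrow> N k \<in> borel_measurable M"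
  using indep_N by (auto simp: M.indep_vars_def)

lemma time_0 [simp]: "time 0 = 0" and time_Suc [simp]: "time (Suc k) = time k + \<delta> (Suc k)"
  by (simp_all add: time_def)

lemma time_nonneg: "k \<le> n \<Longrightarrow> 0 \<le> time k"
  unfolding time_def by (rule sum_nonneg) (auto intro!: less_imp_le \<delta>_pos)

lemma time_pos: "0 < time n"
  unfolding time_def using n_pos by (intro sum_pos) (auto intro!: \<delta>_pos)

lemma measurable_Y: "k \<le> n \<Longrightarrow> Y k \<in> borel_measurable M"
  by (rule measurable_Yproc) (auto intro: N_meas)

lemma distr_signal_noise:
  assumes k: "k \<in> {1..n}"
  shows "distr M (borel \<Otimes>\<^sub>M (\<Pi>\<^sub>M j\<in>{1..k}. borel)) (\<lambda>\<omega>. (X \<omega>, \<lambda>j\<in>{1..k}. N j \<omega>)) = \<mu> \<Otimes>\<^sub>M gauss_noise k"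
proof -
  let ?Z = "\<lambda>i. case i of None \<Rightarrow> X | Some k \<Rightarrow> N k"
  let ?A = "\<lambda>\<omega>. \<lambda>i\<in>{None}. ?Z i \<omega>" and ?B = "\<lambda>\<omega>. \<lambda>i\<in>Some ` {1..k}. ?Z i \<omega>"
  have "M.indep_var (\<Pi>\<^sub>M i\<in>{None}. borel) ?A (\<Pi>\<^sub>M i\<in>Some ` {1..k}. borel) ?B"
    by (rule M.indep_var_restrict[OF indep]) (use k in auto)
  then have eq: "distr M (\<Pi>\<^sub>M i\<in>{None}. borel) ?A \<Otimes>\<^sub>M distr M (\<Pi>\<^sub>M i\<in>Some ` {1..k}. borel) ?B
      = distr M ((\<Pi>\<^sub>M i\<in>{None}. borel) \<Otimes>\<^sub>M (\<Pi>\<^sub>M i\<in>Some ` {1..k}. borel)) (\<lambda>\<omega>. (?A \<omega>, ?B \<omega>))"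
    and [measurable]: "?A \<in> M \<rightarrow>\<^sub>M (\<Pi>\<^sub>M i\<in>{None}. borel)" "?B \<in> M \<rightarrow>\<^sub>M (\<Pi>\<^sub>M i\<in>Some ` {1..k}. borel)"
    by (simp_all add: M.indep_var_distribution_eq)
  let ?\<phi> = "\<lambda>v. v None :: 'a" and ?\<psi> = "\<lambda>v. \<lambda>j\<in>{1..k}. v (Some j) :: 'a"
  have [measurable]: "?\<psi> \<in> (\<Pi>\<^sub>M i\<in>Some ` {1..k}. borel) \<rightarrow>\<^sub>M (\<Pi>\<^sub>M j\<in>{1..k}. borel)"
    by (rule measurable_restrict) simp
  have BN: "?\<psi> (?B \<omega>) = (\<lambda>j\<in>{1..k}. N j \<omega>)" for \<omega>
    by (auto simp: restrict_def fun_eq_iff)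
  have X: "distr (distr M (\<Pi>\<^sub>M i\<in>{None}. borel) ?A) borel ?\<phi> = distr M borel X"
    by (subst distr_distr) (simp_all add: comp_def)
  have N: "distr (distr M (\<Pi>\<^sub>M i\<in>Some ` {1..k}. borel) ?B) (\<Pi>\<^sub>M j\<in>{1..k}. borel) ?\<psi>
      = distr M (\<Pi>\<^sub>M j\<in>{1..k}. borel) (\<lambda>\<omega>. \<lambda>j\<in>{1..k}. N j \<omega>)"
    by (subst distr_distr) (simp_all add: comp_def BN del: restrict_apply)
  have mN: "(\<lambda>\<omega>. \<lambda>j\<in>{1..k}. N j \<omega>) \<in> M \<rightarrow>\<^sub>M (\<Pi>\<^sub>M j\<in>{1..k}. borel)"
    using k by (intro measurable_restrict N_meas) auto
  interpret N: prob_space "distr M (\<Pi>\<^sub>M j\<in>{1..k}. borel) (\<lambda>\<omega>. \<lambda>j\<in>{1..k}. N j \<omega>)"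
    by (rule M.prob_space_distr[OF mN])
  have "distr M borel X \<Otimes>\<^sub>M distr M (\<Pi>\<^sub>M j\<in>{1..k}. borel) (\<lambda>\<omega>. \<lambda>j\<in>{1..k}. N j \<omega>)
      = distr (distr M ((\<Pi>\<^sub>M i\<in>{None}. borel) \<Otimes>\<^sub>M (\<Pi>\<^sub>M i\<in>Some ` {1..k}. borel)) (\<lambda>\<omega>. (?A \<omega>, ?B \<omega>)))
          (borel \<Otimes>\<^sub>M (\<Pi>\<^sub>M j\<in>{1..k}. borel)) (\<lambda>(v, w). (?\<phi> v, ?\<psi> w))"
    unfolding eq[symmetric] X[symmetric] N[symmetric]
  proof (rule pair_measure_distr)
    show "sigma_finite_measure (distr (distr M (\<Pi>\<^sub>M i\<in>Some ` {1..k}. borel) ?B) (\<Pi>\<^sub>M j\<in>{1..k}. borel) ?\<psi>)"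
      unfolding N by (rule N.sigma_finite_measure_axioms)
  qed measurable
  also have "\<dots> = distr M (borel \<Otimes>\<^sub>M (\<Pi>\<^sub>M j\<in>{1..k}. borel)) (\<lambda>\<omega>. (X \<omega>, \<lambda>j\<in>{1..k}. N j \<omega>))"
    by (subst distr_distr, measurable) (simp add: comp_def BN del: restrict_apply, simp)
  finally have "distr M borel X \<Otimes>\<^sub>M distr M (\<Pi>\<^sub>M j\<in>{1..k}. borel) (\<lambda>\<omega>. \<lambda>j\<in>{1..k}. N j \<omega>)
      = distr M (borel \<Otimes>\<^sub>M (\<Pi>\<^sub>M j\<in>{1..k}. borel)) (\<lambda>\<omega>. (X \<omega>, \<lambda>j\<in>{1..k}. N j \<omega>))" .
  moreover have "distr M (\<Pi>\<^sub>M j\<in>{1..k}. borel) (\<lambda>\<omega>. \<lambda>j\<in>{1..k}. N j \<omega>) = gauss_noise k"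
    by (rule M.distr_indep_gauss_noise) (use k in \<open>auto intro: M.indep_vars_subset[OF indep_N] N_law\<close>)
  ultimately show ?thesis by (simp add: X_law)
qed

lemma nn_integral_signal_noise:
  assumes k: "k \<in> {1..n}"
    and g: "(\<lambda>(x, v). g x v) \<in> borel_measurable (borel \<Otimes>\<^sub>M (\<Pi>\<^sub>M j\<in>{1..k}. borel))"
  shows "(\<integral>\<^sup>+\<omega>. g (X \<omega>) (\<lambda>j\<in>{1..k}. N j \<omega>) \<partial>M) = (\<integral>\<^sup>+x. \<integral>\<^sup>+v. g x v \<partial>gauss_noise k \<partial>\<mu>)"
proof -
  interpret G: sigma_finite_measure "gauss_noise k :: (nat \<Rightarrow> 'a) measure"
    by (rule gauss_noise.sigma_finite) simp
  have m: "(\<lambda>\<omega>. (X \<omega>, \<lambda>j\<in>{1..k}. N j \<omega>)) \<in> M \<rightarrow>\<^sub>M borel \<Otimes>\<^sub>M (\<Pi>\<^sub>M j\<in>{1..k}. borel)"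
    using k by (intro measurable_Pair measurable_restrict N_meas) auto
  have s: "sets (\<mu> \<Otimes>\<^sub>M gauss_noise k) = sets (borel \<Otimes>\<^sub>M (\<Pi>\<^sub>M j\<in>{1..k}. (borel :: 'a measure)))"
    by (rule sets_pair_measure_cong) (simp_all add: sets_prior sets_gauss_noise)
  have "(\<integral>\<^sup>+\<omega>. g (X \<omega>) (\<lambda>j\<in>{1..k}. N j \<omega>) \<partial>M) = (\<integral>\<^sup>+(x, v). g x v \<partial>(\<mu> \<Otimes>\<^sub>M gauss_noise k))"
    unfolding distr_signal_noise[OF k, symmetric] by (subst nn_integral_distr[OF m]) (use g in simp_all)
  also have "\<dots> = (\<integral>\<^sup>+x. \<integral>\<^sup>+v. g x v \<partial>gauss_noise k \<partial>\<mu>)"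
    by (subst G.nn_integral_fst[symmetric]) (use g in \<open>simp_all add: measurable_cong_sets[OF s refl]\<close>)
  finally show ?thesis .
qed

lemma Zproc_const_drift: "Zproc \<delta> (\<lambda>_ _. x) V k v = time k *\<^sub>R x + Zproc \<delta> (\<lambda>_ _. 0) V k v"
  by (induction k) (simp_all add: algebra_simps)

lemma Y_eq: "Y k \<omega> = time k *\<^sub>R X \<omega> + Zproc \<delta> (\<lambda>_ _. 0) (\<lambda>k v. v k) k (\<lambda>j\<in>{1..k}. N j \<omega>)"
proof -
  have "Zproc \<delta> (\<lambda>_ _. 0) N k \<omega> = Zproc \<delta> (\<lambda>_ _. 0) (\<lambda>k v. v k) k (\<lambda>j\<in>{1..k}. N j \<omega>)"
    by (rule Zproc_cong) auto
  then show ?thesis by (simp add: Yproc_eq_Zproc Zproc_const_drift[of "X \<omega>"])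
qed

text \<open>Given the signal, \<open>Y k\<close> is \<open>time k *\<^sub>R X\<close> plus a
  Gaussian of variance \<open>time k\<close>, hence a rescaled channel output at level
  \<open>time k\<close>. This carries every result about the channel over to the process.\<close>

lemma nn_integral_signal_Y:
  assumes k: "k \<le> n" and [measurable]: "g \<in> borel_measurable (borel \<Otimes>\<^sub>M borel)"
  shows "(\<integral>\<^sup>+\<omega>. g (X \<omega>, Y k \<omega>) \<partial>M)
    = (\<integral>\<^sup>+\<omega>. g (fst \<omega>, sqrt (time k) *\<^sub>R chan_out (time k) \<omega>) \<partial>chan_space \<mu>)"
proof (cases "k = 0")
  case True
  have "(\<integral>\<^sup>+\<omega>. g (X \<omega>, 0) \<partial>M) = (\<integral>\<^sup>+x. g (x, 0) \<partial>\<mu>)"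
    unfolding X_law[symmetric] by (subst nn_integral_distr) simp_all
  also have "\<dots> = (\<integral>\<^sup>+x. \<integral>\<^sup>+u. g (x, 0) \<partial>(std_gauss :: 'a measure) \<partial>\<mu>)"
    using std_gauss.emeasure_space_1[where 'a='a] by simp
  also have "\<dots> = (\<integral>\<^sup>+\<omega>. g (fst \<omega>, 0) \<partial>chan_space \<mu>)"
    by (subst nn_integral_chan) simp_all
  finally show ?thesis using True by simp
next
  case False
  with k have k: "k \<in> {1..n}" by auto
  let ?S = "Zproc \<delta> (\<lambda>_ _. 0) (\<lambda>k v. v k) k"
  have [measurable]: "?S \<in> borel_measurable (\<Pi>\<^sub>M j\<in>{1..k}. (borel :: 'a measure))"
    by (rule measurable_Zproc) auto
  have "(\<integral>\<^sup>+\<omega>. g (X \<omega>, Y k \<omega>) \<partial>M) = (\<integral>\<^sup>+x. \<integral>\<^sup>+v. g (x, time k *\<^sub>R x + ?S v) \<partial>gauss_noise k \<partial>\<mu>)"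
    unfolding Y_eq by (rule nn_integral_signal_noise[OF k]) measurable
  also have "\<dots> = (\<integral>\<^sup>+x. \<integral>\<^sup>+u. g (x, time k *\<^sub>R x + sqrt (time k) *\<^sub>R u) \<partial>std_gauss \<partial>\<mu>)"
  proof (rule nn_integral_cong)
    fix x :: 'a
    show "(\<integral>\<^sup>+v. g (x, time k *\<^sub>R x + ?S v) \<partial>gauss_noise k)
        = (\<integral>\<^sup>+u. g (x, time k *\<^sub>R x + sqrt (time k) *\<^sub>R u) \<partial>std_gauss)"
      unfolding time_def
      by (rule nn_integral_gauss_walk[where g="\<lambda>u. g (x, (\<Sum>j=1..k. \<delta> j) *\<^sub>R x + u)"])
         (use k in \<open>auto intro!: \<delta>_pos\<close>)
  qed
  also have "\<dots> = (\<integral>\<^sup>+\<omega>. g (fst \<omega>, sqrt (time k) *\<^sub>R chan_out (time k) \<omega>) \<partial>chan_space \<mu>)"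
    using time_nonneg[of k] k by (subst nn_integral_chan) (simp_all add: chan_out_def scaleR_add_right)
  finally show ?thesis .
qed

lemma distr_signal_Y:
  assumes k: "k \<le> n"
  shows "distr M (borel \<Otimes>\<^sub>M borel) (\<lambda>\<omega>. (X \<omega>, Y k \<omega>))
    = distr (chan_space \<mu>) (borel \<Otimes>\<^sub>M borel) (\<lambda>\<omega>. (fst \<omega>, sqrt (time k) *\<^sub>R chan_out (time k) \<omega>))" (is "?L = ?R")
proof (rule measure_eqI)
  fix A assume "A \<in> sets ?L"
  then have A [measurable]: "A \<in> sets (borel \<Otimes>\<^sub>M borel)" by simp
  note [measurable] = measurable_Y[OF k]
  have R: "emeasure ?R A = (\<integral>\<^sup>+\<omega>. indicator A (fst \<omega>, sqrt (time k) *\<^sub>R chan_out (time k) \<omega>) \<partial>chan_space \<mu>)"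
    by (subst nn_integral_indicator[symmetric], simp, subst nn_integral_distr) simp_all
  have "emeasure ?L A = (\<integral>\<^sup>+\<omega>. indicator A (X \<omega>, Y k \<omega>) \<partial>M)"
    by (subst nn_integral_indicator[symmetric], simp, subst nn_integral_distr) simp_all
  also have "\<dots> = (\<integral>\<^sup>+\<omega>. indicator A (fst \<omega>, sqrt (time k) *\<^sub>R chan_out (time k) \<omega>) \<partial>chan_space \<mu>)"
    by (rule nn_integral_signal_Y[OF k]) simp
  also have "\<dots> = emeasure ?R A" unfolding R ..
  finally show "emeasure ?L A = emeasure ?R A" .
qed simp

lemma
  fixes \<phi> :: "'a \<times> 'a \<Rightarrow> real"
  assumes k: "k \<le> n" and [measurable]: "\<phi> \<in> borel_measurable (borel \<Otimes>\<^sub>M borel)"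
  shows integrable_signal_Y: "integrable M (\<lambda>\<omega>. \<phi> (X \<omega>, Y k \<omega>))
      \<longleftrightarrow> integrable (chan_space \<mu>) (\<lambda>\<omega>. \<phi> (fst \<omega>, sqrt (time k) *\<^sub>R chan_out (time k) \<omega>))" (is ?A)
    and integral_signal_Y: "(\<integral>\<omega>. \<phi> (X \<omega>, Y k \<omega>) \<partial>M)
      = (\<integral>\<omega>. \<phi> (fst \<omega>, sqrt (time k) *\<^sub>R chan_out (time k) \<omega>) \<partial>chan_space \<mu>)" (is ?B)
proof -
  note [measurable] = measurable_Y[OF k]
  have m: "(\<lambda>\<omega>. (X \<omega>, Y k \<omega>)) \<in> M \<rightarrow>\<^sub>M borel \<Otimes>\<^sub>M borel"
    "(\<lambda>\<omega>. (fst \<omega>, sqrt (time k) *\<^sub>R chan_out (time k) \<omega>)) \<in> chan_space \<mu> \<rightarrow>\<^sub>M borel \<Otimes>\<^sub>M borel"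
    by measurable
  show ?A
    using integrable_distr_eq[OF m(1), of \<phi>] integrable_distr_eq[OF m(2), of \<phi>] by (simp add: distr_signal_Y[OF k])
  show ?B
    using integral_distr[OF m(1), of \<phi>] integral_distr[OF m(2), of \<phi>] by (simp add: distr_signal_Y[OF k])
qed

lemma real_cond_exp_Y:
  assumes k: "k \<le> n"
  shows "AE \<omega> in M. real_cond_exp M (vimage_algebra (space M) (Y k) borel) (\<lambda>\<omega>'. X \<omega>' \<bullet> b) \<omega>
    = tilt_mean \<mu> (time k) (Y k \<omega>) \<bullet> b"
proof (rule M.real_cond_exp_vimage_algebra_eqI[where g="\<lambda>y. tilt_mean \<mu> (time k) y \<bullet> b"])
  note t = time_nonneg[OF k]
  show "Y k \<in> M \<rightarrow>\<^sub>M borel" by (rule measurable_Y[OF k])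
  show "integrable M (\<lambda>\<omega>. X \<omega> \<bullet> b)"
    using integrable_signal_Y[OF k, of "\<lambda>z. fst z \<bullet> b"] integrable_chan_fst_inner by simp
  show "integrable M (\<lambda>\<omega>. tilt_mean \<mu> (time k) (Y k \<omega>) \<bullet> b)"
    using integrable_signal_Y[OF k, of "\<lambda>z. tilt_mean \<mu> (time k) (snd z) \<bullet> b"]
      integrable_posterior_mean_inner[OF t, of "\<lambda>_. b"] integrable_chan_fst_inner by simp
  fix B :: "'a set" assume B [measurable]: "B \<in> sets borel"
  \<comment> \<open>The event concerns \<open>Y k\<close>, whereas orthogonality is stated for the
    unscaled output, so the scaling moves into the test function.\<close>
  let ?h = "\<lambda>u. indicator B (sqrt (time k) *\<^sub>R u) *\<^sub>R b"
  have "integrable (chan_space \<mu>) (\<lambda>\<omega>. fst \<omega> \<bullet> ?h (chan_out (time k) \<omega>))"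
  proof (rule Bochner_Integration.integrable_bound[OF integrable_chan_fst_inner])
    show "AE \<omega> in chan_space \<mu>. norm (fst \<omega> \<bullet> ?h (chan_out (time k) \<omega>)) \<le> norm (fst \<omega> \<bullet> b)"
      by (auto simp: indicator_def)
  qed measurable
  from integral_posterior_mean_inner[OF t _ this]
  show "(\<integral>\<omega>. indicator B (Y k \<omega>) * (X \<omega> \<bullet> b) \<partial>M)
      = (\<integral>\<omega>. indicator B (Y k \<omega>) * (tilt_mean \<mu> (time k) (Y k \<omega>) \<bullet> b) \<partial>M)"
    using integral_signal_Y[OF k, of "\<lambda>z. indicator B (snd z) * (fst z \<bullet> b)"]
      integral_signal_Y[OF k, of "\<lambda>z. indicator B (snd z) * (tilt_mean \<mu> (time k) (snd z) \<bullet> b)"]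
    by simp
qed measurable

text \<open>For a constant drift the stochastic sum telescopes: the endpoint of the path is a
  sufficient statistic for the signal.\<close>

lemma log_lik_const: "log_lik \<delta> (\<lambda>_ _. x) k y = x \<bullet> path_at y k - time k / 2 * (norm x)\<^sup>2"
proof (induction k)
  case 0
  then show ?case by (simp add: log_lik_def path_at_def)
next
  case (Suc k)
  then show ?case by (simp add: log_lik_def inner_diff_right algebra_simps add_divide_distrib)
qed

text \<open>At the positive final time every point is of the form for which \<open>tilt_norm\<close>
  is known to be finite and positive.\<close>

lemma scaled_back: "sqrt (time n) *\<^sub>R ((1 / sqrt (time n)) *\<^sub>R y) = y" for y :: 'a
  using time_pos by simp

text \<open>\<open>Y\<close> is a mixture over the prior of walks with constant drift. Each has a
  likelihood depending on the endpoint alone, so Fubini averages it to \<open>tilt_norm\<close>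
  there.\<close>

lemma path_law_Y:
  "path_law M n Y = density (walk_law \<delta> n) (\<lambda>y. ennreal (tilt_norm \<mu> (time n) (path_at y n)))"
    (is "?L = ?R")
proof (rule measure_eqI)
  show "sets ?L = sets ?R" by (simp add: path_law_def)
  fix A assume "A \<in> sets ?L"
  then have A [measurable]: "A \<in> sets (\<Pi>\<^sub>M k\<in>{1..n}. borel)" by (simp add: path_law_def)
  let ?S = "drift_path \<delta> (\<lambda>_ _. 0 :: 'a) n"
  interpret G: sigma_finite_measure "gauss_noise n :: (nat \<Rightarrow> 'a) measure"
    by (rule gauss_noise.sigma_finite) simp
  interpret MG: pair_sigma_finite \<mu> "gauss_noise n :: (nat \<Rightarrow> 'a) measure" ..
  have [measurable]: "(\<lambda>y. path_at y n) \<in> borel_measurable (\<Pi>\<^sub>M k\<in>{1..n}. (borel :: 'a measure))"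
    by (rule measurable_path_at) simp
  have mY: "(\<lambda>\<omega>. \<lambda>k\<in>{1..n}. Y k \<omega>) \<in> M \<rightarrow>\<^sub>M (\<Pi>\<^sub>M k\<in>{1..n}. borel)"
    by (intro measurable_restrict measurable_Y) auto
  have path: "(\<lambda>k\<in>{1..n}. Y k \<omega>) = drift_path \<delta> (\<lambda>_ _. X \<omega>) n (\<lambda>k\<in>{1..n}. N k \<omega>)" for \<omega>
    unfolding drift_path_def Yproc_eq_Zproc by (intro restrict_ext Zproc_cong) auto
  have mD: "(\<lambda>(x, v). drift_path \<delta> (\<lambda>_ _. x) n v) \<in> borel \<Otimes>\<^sub>M (\<Pi>\<^sub>M k\<in>{1..n}. (borel :: 'a measure))
      \<rightarrow>\<^sub>M (\<Pi>\<^sub>M k\<in>{1..n}. borel)"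
  proof -
    have "(\<lambda>(x, v). drift_path \<delta> (\<lambda>_ _. x) n v) = (\<lambda>\<omega>. \<lambda>k\<in>{1..n}. Yproc \<delta> fst (\<lambda>j \<omega>. snd \<omega> j) k \<omega>)"
      unfolding drift_path_def Yproc_eq_Zproc by (auto simp: fun_eq_iff intro!: Zproc_cong)
    also have "\<dots> \<in> borel \<Otimes>\<^sub>M (\<Pi>\<^sub>M k\<in>{1..n}. (borel :: 'a measure)) \<rightarrow>\<^sub>M (\<Pi>\<^sub>M k\<in>{1..n}. borel)"
      by (intro measurable_restrict measurable_Yproc) auto
    finally show ?thesis .
  qed
  have "emeasure ?L A = (\<integral>\<^sup>+\<omega>. indicator A (\<lambda>k\<in>{1..n}. Y k \<omega>) \<partial>M)"
    unfolding path_law_def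
    by (subst nn_integral_indicator[symmetric], simp, subst nn_integral_distr[OF mY]) simp_all
  also have "\<dots> = (\<integral>\<^sup>+x. \<integral>\<^sup>+v. indicator A (drift_path \<delta> (\<lambda>_ _. x) n v) \<partial>gauss_noise n \<partial>\<mu>)"
    unfolding path
    by (rule nn_integral_signal_noise)
       (use n_pos measurable_compose[OF mD borel_measurable_indicator[OF A]] in \<open>auto simp: split_beta'\<close>)
  also have "\<dots> = (\<integral>\<^sup>+x. \<integral>\<^sup>+v. indicator A (?S v) * ennreal (tilt (time n) x (path_at (?S v) n)) \<partial>gauss_noise n \<partial>\<mu>)"
  proof (rule nn_integral_cong)
    fix x :: 'a
    have "(\<integral>\<^sup>+v. indicator A (drift_path \<delta> (\<lambda>_ _. x) n v) \<partial>gauss_noise n)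
        = (\<integral>\<^sup>+v. indicator A (?S v) * ennreal (exp (log_lik \<delta> (\<lambda>_ _. x) n (?S v))) \<partial>gauss_noise n)"
      by (rule nn_integral_drift_path) (auto intro!: less_imp_le \<delta>_pos)
    then show "(\<integral>\<^sup>+v. indicator A (drift_path \<delta> (\<lambda>_ _. x) n v) \<partial>gauss_noise n)
        = (\<integral>\<^sup>+v. indicator A (?S v) * ennreal (tilt (time n) x (path_at (?S v) n)) \<partial>gauss_noise n)"
      by (simp add: log_lik_const tilt_def)
  qed
  also have "\<dots> = (\<integral>\<^sup>+v. \<integral>\<^sup>+x. indicator A (?S v) * ennreal (tilt (time n) x (path_at (?S v) n)) \<partial>\<mu> \<partial>gauss_noise n)"
    by (rule MG.Fubini'[symmetric]) measurable
  also have "\<dots> = (\<integral>\<^sup>+v. indicator A (?S v) * ennreal (tilt_norm \<mu> (time n) (path_at (?S v) n)) \<partial>gauss_noise n)"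
  proof (rule nn_integral_cong)
    fix v :: "nat \<Rightarrow> 'a"
    have "integrable \<mu> (\<lambda>x. tilt (time n) x (path_at (?S v) n))"
      using integrable_tilt[of "time n" "(1 / sqrt (time n)) *\<^sub>R path_at (?S v) n"] time_pos
      unfolding scaled_back by simp
    then show "(\<integral>\<^sup>+x. indicator A (?S v) * ennreal (tilt (time n) x (path_at (?S v) n)) \<partial>\<mu>)
        = indicator A (?S v) * ennreal (tilt_norm \<mu> (time n) (path_at (?S v) n))"
      by (simp add: nn_integral_cmult nn_integral_eq_integral tilt_norm_def)
  qed
  also have "\<dots> = (\<integral>\<^sup>+y. indicator A y * ennreal (tilt_norm \<mu> (time n) (path_at y n)) \<partial>walk_law \<delta> n)"
    unfolding walk_law_def by (subst nn_integral_distr) simp_all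
  also have "\<dots> = emeasure ?R A"
    by (subst emeasure_density) (auto simp: mult.commute)
  finally show "emeasure ?L A = emeasure ?R A" .
qed

text \<open>\<open>Y (k - 1)\<close> is a function of the signal and the first \<open>k - 1\<close>
  noises, a block of indices disjoint from \<open>{Some k}\<close>.\<close>

lemma indep_var_Y_N:
  fixes g h :: "'a \<Rightarrow> real"
  assumes k: "k \<in> {1..n}" and [measurable]: "g \<in> borel_measurable borel" "h \<in> borel_measurable borel"
  shows "M.indep_var borel (\<lambda>\<omega>. g (Y (k - 1) \<omega>)) borel (\<lambda>\<omega>. h (N k \<omega>))"
proof -
  let ?Z = "\<lambda>i. case i of None \<Rightarrow> X | Some k \<Rightarrow> N k"
  let ?I = "insert None (Some ` {1..k - 1})"
  let ?Y = "Yproc \<delta> (\<lambda>v. v None) (\<lambda>j v. v (Some j)) (k - 1)"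
  have [measurable]: "?Y \<in> borel_measurable (\<Pi>\<^sub>M i\<in>?I. (borel :: 'a measure))"
    by (rule measurable_Yproc) auto
  have "M.indep_var (\<Pi>\<^sub>M i\<in>?I. borel) (\<lambda>\<omega>. \<lambda>i\<in>?I. ?Z i \<omega>) (\<Pi>\<^sub>M i\<in>{Some k}. borel) (\<lambda>\<omega>. \<lambda>i\<in>{Some k}. ?Z i \<omega>)"
    by (rule M.indep_var_restrict[OF indep]) (use k in auto)
  then have "M.indep_var borel ((\<lambda>v. g (?Y v)) \<circ> (\<lambda>\<omega>. \<lambda>i\<in>?I. ?Z i \<omega>))
      borel ((\<lambda>v. h (v (Some k))) \<circ> (\<lambda>\<omega>. \<lambda>i\<in>{Some k}. ?Z i \<omega>))"
    by (rule M.indep_var_compose) measurable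
  moreover have "?Y (\<lambda>i\<in>?I. ?Z i \<omega>) = Y (k - 1) \<omega>" for \<omega>
    by (rule Yproc_cong) auto
  ultimately show ?thesis by (simp add: comp_def)
qed

section \<open>Expectation of the log-likelihood along the observations\<close>

lemma integrable_N_norm2: "k \<in> {1..n} \<Longrightarrow> integrable M (\<lambda>\<omega>. (norm (N k \<omega>))\<^sup>2)"
  using integrable_distr_eq[OF N_meas, of k "\<lambda>x. (norm x)\<^sup>2"] integrable_std_gauss_norm2[where 'a='a]
  by (simp add: N_law)

text \<open>The martingale part of the Girsanov exponent: in each coordinate the noise is centred
  and independent of the integrand.\<close>

lemma integral_inner_noise:
  assumes k: "k \<in> {1..n}" and [measurable]: "F \<in> borel_measurable borel"
    and F2: "integrable M (\<lambda>\<omega>. (norm (F (Y (k - 1) \<omega>)))\<^sup>2)"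
  shows "(\<integral>\<omega>. F (Y (k - 1) \<omega>) \<bullet> N k \<omega> \<partial>M) = 0"
proof -
  have [measurable]: "Y (k - 1) \<in> borel_measurable M" "N k \<in> borel_measurable M"
    using k by (auto intro!: measurable_Y N_meas)
  have b: "integrable M (\<lambda>\<omega>. (F (Y (k - 1) \<omega>) \<bullet> b) * (N k \<omega> \<bullet> b))"
      "(\<integral>\<omega>. (F (Y (k - 1) \<omega>) \<bullet> b) * (N k \<omega> \<bullet> b) \<partial>M) = 0" for b
  proof -
    have ind: "M.indep_var borel (\<lambda>\<omega>. F (Y (k - 1) \<omega>) \<bullet> b) borel (\<lambda>\<omega>. N k \<omega> \<bullet> b)"
      by (rule indep_var_Y_N[OF k]) measurable
    have i1: "integrable M (\<lambda>\<omega>. F (Y (k - 1) \<omega>) \<bullet> b)"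
      by (rule integrable_inner_square_integrable) (use F2 in auto)
    have i2: "integrable M (\<lambda>\<omega>. N k \<omega> \<bullet> b)"
      by (rule integrable_inner_square_integrable) (use integrable_N_norm2[OF k] in auto)
    have "(\<integral>\<omega>. N k \<omega> \<bullet> b \<partial>M) = 0"
      using integral_distr[OF N_meas[OF k], of "\<lambda>x. x \<bullet> b"] by (simp add: N_law[OF k] integral_std_gauss_inner)
    then show "(\<integral>\<omega>. (F (Y (k - 1) \<omega>) \<bullet> b) * (N k \<omega> \<bullet> b) \<partial>M) = 0"
      by (simp add: M.indep_var_lebesgue_integral[OF ind i1 i2])
    show "integrable M (\<lambda>\<omega>. (F (Y (k - 1) \<omega>) \<bullet> b) * (N k \<omega> \<bullet> b))"
      by (rule M.indep_var_integrable[OF ind i1 i2])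
  qed
  have "(\<integral>\<omega>. F (Y (k - 1) \<omega>) \<bullet> N k \<omega> \<partial>M)
      = (\<integral>\<omega>. (\<Sum>b\<in>Basis. (F (Y (k - 1) \<omega>) \<bullet> b) * (N k \<omega> \<bullet> b)) \<partial>M)"
    by (subst euclidean_inner) simp
  also have "\<dots> = 0"
    by (subst Bochner_Integration.integral_sum) (simp_all add: b)
  finally show ?thesis .
qed

text \<open>The estimator may be any version of the conditional mean. The divergence is an
  expectation under the law of \<open>Y\<close>, so agreement along \<open>Y\<close> suffices to
  compute it.\<close>

lemma conditional_mean_eq:
  assumes k: "k \<in> {1..n}"
    and f: "\<And>b. b \<in> Basis \<Longrightarrow> AE \<omega> in M. f (Y (k - 1) \<omega>) \<bullet> b
      = real_cond_exp M (vimage_algebra (space M) (Y (k - 1)) borel) (\<lambda>\<omega>'. X \<omega>' \<bullet> b) \<omega>"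
  shows "AE \<omega> in M. f (Y (k - 1) \<omega>) = tilt_mean \<mu> (time (k - 1)) (Y (k - 1) \<omega>)"
proof -
  have "AE \<omega> in M. \<forall>b\<in>Basis. f (Y (k - 1) \<omega>) \<bullet> b = tilt_mean \<mu> (time (k - 1)) (Y (k - 1) \<omega>) \<bullet> b"
  proof (rule AE_finite_allI)
    fix b :: 'a assume "b \<in> Basis"
    moreover have "k - 1 \<le> n" using k by auto
    ultimately show "AE \<omega> in M. f (Y (k - 1) \<omega>) \<bullet> b = tilt_mean \<mu> (time (k - 1)) (Y (k - 1) \<omega>) \<bullet> b"
      using f[of b] real_cond_exp_Y[of "k - 1" b] by auto
  qed simp
  then show ?thesis by (rule eventually_mono) (auto intro: euclidean_eqI)
qed

text \<open>The increment is \<open>\<delta> k *\<^sub>R X\<close> plus centred noise. By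
  orthogonality the signal part contributes \<open>\<delta> k\<close> times the energy of the
  posterior mean, and the quadratic term removes half of it.\<close>

lemma
  assumes k: "k \<in> {1..n}" and [measurable]: "f \<in> borel_measurable borel"
    and f: "AE \<omega> in M. f (Y (k - 1) \<omega>) = tilt_mean \<mu> (time (k - 1)) (Y (k - 1) \<omega>)"
  shows integrable_log_lik_term: "integrable M (\<lambda>\<omega>. f (Y (k - 1) \<omega>) \<bullet> (Y k \<omega> - Y (k - 1) \<omega>)
        - \<delta> k / 2 * (norm (f (Y (k - 1) \<omega>)))\<^sup>2)" (is ?int)
    and integral_log_lik_term: "(\<integral>\<omega>. f (Y (k - 1) \<omega>) \<bullet> (Y k \<omega> - Y (k - 1) \<omega>)
        - \<delta> k / 2 * (norm (f (Y (k - 1) \<omega>)))\<^sup>2 \<partial>M) = \<delta> k / 2 * mean_energy (time (k - 1))" (is ?eq)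
proof -
  have k1: "k - 1 \<le> n" using k by auto
  note t = time_nonneg[OF k1]
  let ?m = "\<lambda>\<omega>. tilt_mean \<mu> (time (k - 1)) (Y (k - 1) \<omega>)" and ?f = "\<lambda>\<omega>. f (Y (k - 1) \<omega>)"
  have [measurable]: "Y (k - 1) \<in> borel_measurable M" "N k \<in> borel_measurable M"
    using k by (auto intro!: measurable_Y N_meas)
  have X2: "integrable M (\<lambda>\<omega>. (norm (X \<omega>))\<^sup>2)"
    using integrable_signal_Y[OF k1, of "\<lambda>z. (norm (fst z))\<^sup>2"] integrable_chan_fst_norm2 by simp
  have m2: "integrable M (\<lambda>\<omega>. (norm (?m \<omega>))\<^sup>2)" "(\<integral>\<omega>. (norm (?m \<omega>))\<^sup>2 \<partial>M) = mean_energy (time (k - 1))"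
    using integrable_signal_Y[OF k1, of "\<lambda>z. (norm (tilt_mean \<mu> (time (k - 1)) (snd z)))\<^sup>2"]
      integral_signal_Y[OF k1, of "\<lambda>z. (norm (tilt_mean \<mu> (time (k - 1)) (snd z)))\<^sup>2"]
      integrable_posterior_mean_norm2[OF t] by (simp_all add: mean_energy_def)
  have mX: "(\<integral>\<omega>. X \<omega> \<bullet> ?m \<omega> \<partial>M) = mean_energy (time (k - 1))"
    using integral_signal_Y[OF k1, of "\<lambda>z. fst z \<bullet> tilt_mean \<mu> (time (k - 1)) (snd z)"]
      integral_fst_inner_posterior_mean[OF t] by simp
  have f2: "integrable M (\<lambda>\<omega>. (norm (?f \<omega>))\<^sup>2)"
    by (rule integrable_cong_AE_imp[OF m2(1)]) (use f in \<open>auto elim: eventually_mono\<close>)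
  have f2': "(\<integral>\<omega>. (norm (?f \<omega>))\<^sup>2 \<partial>M) = mean_energy (time (k - 1))"
    unfolding m2(2)[symmetric] by (rule integral_cong_AE) (use f in \<open>auto elim: eventually_mono\<close>)
  have fX: "integrable M (\<lambda>\<omega>. ?f \<omega> \<bullet> X \<omega>)"
    by (rule integrable_inner_square_integrable) (use f2 X2 in auto)
  have fX': "(\<integral>\<omega>. ?f \<omega> \<bullet> X \<omega> \<partial>M) = mean_energy (time (k - 1))"
    unfolding mX[symmetric] by (rule integral_cong_AE) (use f in \<open>auto simp: inner_commute elim: eventually_mono\<close>)
  have fN: "integrable M (\<lambda>\<omega>. ?f \<omega> \<bullet> N k \<omega>)"
    by (rule integrable_inner_square_integrable) (use f2 integrable_N_norm2[OF k] in auto)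
  have fN': "(\<integral>\<omega>. ?f \<omega> \<bullet> N k \<omega> \<partial>M) = 0"
    by (rule integral_inner_noise[OF k _ f2]) measurable
  have Y: "Y k \<omega> - Y (k - 1) \<omega> = \<delta> k *\<^sub>R X \<omega> + sqrt (\<delta> k) *\<^sub>R N k \<omega>" for \<omega>
    using k by (cases k) auto
  show ?int
    unfolding Y inner_add_right inner_scaleR_right using f2 fX fN by auto
  show ?eq
    unfolding Y inner_add_right inner_scaleR_right using f2 fX fN by (simp add: f2' fX' fN')
qed

text \<open>The log ratio of the two densities relative to the walk is the log of
  \<open>tilt_norm\<close> at the endpoint minus \<open>log_lik\<close>, and both have known means
  under \<open>Y\<close>. The formula is exact; the loss in the theorem comes entirely from the
  lower bound on \<open>info\<close>.\<close>

lemma KL_div_path_law: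
  fixes M' :: "'c measure" and N' :: "nat \<Rightarrow> 'c \<Rightarrow> 'a" and f :: "nat \<Rightarrow> 'a \<Rightarrow> 'a"
  assumes M': "prob_space M'"
    and N'_law: "\<And>k. k \<in> {1..n} \<Longrightarrow> distr M' borel (N' k) = std_gauss"
    and N'_indep: "prob_space.indep_vars M' (\<lambda>_. borel) N' {1..n}"
    and f_meas: "\<And>k. k \<in> {1..n} \<Longrightarrow> f k \<in> borel_measurable borel"
    and f_mean: "\<And>k b. k \<in> {1..n} \<Longrightarrow> b \<in> Basis \<Longrightarrow> AE \<omega> in M. f k (Y (k - 1) \<omega>) \<bullet> b
      = real_cond_exp M (vimage_algebra (space M) (Y (k - 1)) borel) (\<lambda>\<omega>'. X \<omega>' \<bullet> b) \<omega>"
  shows "KL_div (path_law M n Y) (path_law M' n (Zproc \<delta> f N'))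
    = ereal ((\<Sum>k=1..n. \<delta> k / 2 * mmse \<mu> (time (k - 1))) - info (time n))"
proof -
  interpret M': prob_space M' by fact
  have t: "0 \<le> time n" using time_pos by simp
  let ?p = "\<lambda>y. tilt_norm \<mu> (time n) (path_at y n)" and ?q = "\<lambda>y. exp (log_lik \<delta> f n y)"
  have Q: "path_law M' n (Zproc \<delta> f N') = density (walk_law \<delta> n) ?q"
    by (rule M'.path_law_Zproc[OF n_pos N'_indep N'_law f_meas \<delta>_pos])
  have [measurable]: "log_lik \<delta> f n \<in> borel_measurable (\<Pi>\<^sub>M k\<in>{1..n}. borel)"
    by (rule measurable_log_lik) (rule f_meas)
  have [measurable]: "(\<lambda>y. path_at y n) \<in> borel_measurable (\<Pi>\<^sub>M k\<in>{1..n}. (borel :: 'a measure))"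
    by (rule measurable_path_at) simp
  have p_pos: "0 < tilt_norm \<mu> (time n) y" for y
    using tilt_norm_pos[OF t, of "(1 / sqrt (time n)) *\<^sub>R y"] unfolding scaled_back .
  have sf: "sigma_finite_measure (density (walk_law \<delta> n) ?q)"
  proof -
    have "prob_space (path_law M' n (Zproc \<delta> f N'))"
      unfolding path_law_def
      by (intro M'.prob_space_distr measurable_restrict measurable_Zproc)
         (use f_meas N'_indep in \<open>auto simp: M'.indep_vars_def\<close>)
    then interpret Q: prob_space "path_law M' n (Zproc \<delta> f N')" .
    show ?thesis using Q.sigma_finite_measure_axioms unfolding Q .
  qed
  let ?Y = "\<lambda>\<omega>. \<lambda>k\<in>{1..n}. Y k \<omega>"
  have mY: "?Y \<in> M \<rightarrow>\<^sub>M (\<Pi>\<^sub>M k\<in>{1..n}. borel)"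
    by (intro measurable_restrict measurable_Y) auto
  have path_Y: "path_at (?Y \<omega>) k = Y k \<omega>" if "k \<le> n" for k \<omega>
    using that by (cases k) (auto simp: path_at_def)
  let ?l = "\<lambda>k \<omega>. f k (Y (k - 1) \<omega>) \<bullet> (Y k \<omega> - Y (k - 1) \<omega>) - \<delta> k / 2 * (norm (f k (Y (k - 1) \<omega>)))\<^sup>2"
  have ll: "log_lik \<delta> f n (?Y \<omega>) = (\<Sum>k=1..n. ?l k \<omega>)" for \<omega>
    unfolding log_lik_def by (intro sum.cong) (auto simp: path_Y)
  have ln_eq: "ln (?p (?Y \<omega>) / ?q (?Y \<omega>)) = ln (tilt_norm \<mu> (time n) (Y n \<omega>)) - (\<Sum>k=1..n. ?l k \<omega>)" for \<omega>
    using p_pos[of "Y n \<omega>"] by (simp add: path_Y ll ln_div)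
  have lnY: "integrable M (\<lambda>\<omega>. ln (tilt_norm \<mu> (time n) (Y n \<omega>)))"
      "(\<integral>\<omega>. ln (tilt_norm \<mu> (time n) (Y n \<omega>)) \<partial>M) = log_norm_energy (time n)"
    using integrable_signal_Y[of n "\<lambda>z. ln (tilt_norm \<mu> (time n) (snd z))"]
      integral_signal_Y[of n "\<lambda>z. ln (tilt_norm \<mu> (time n) (snd z))"] integrable_ln_tilt_norm[OF t]
    by (simp_all add: log_norm_energy_def)
  have l: "integrable M (?l k)" "(\<integral>\<omega>. ?l k \<omega> \<partial>M) = \<delta> k / 2 * mean_energy (time (k - 1))" if k: "k \<in> {1..n}" for k
    by (rule integrable_log_lik_term integral_log_lik_term; use k f_meas conditional_mean_eq[OF k f_mean[OF k]] in auto)+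
  have sum_l: "integrable M (\<lambda>\<omega>. \<Sum>k=1..n. ?l k \<omega>)"
      "(\<integral>\<omega>. (\<Sum>k=1..n. ?l k \<omega>) \<partial>M) = (\<Sum>k=1..n. \<delta> k / 2 * mean_energy (time (k - 1)))"
  proof -
    show "integrable M (\<lambda>\<omega>. \<Sum>k=1..n. ?l k \<omega>)"
      by (rule Bochner_Integration.integrable_sum) (rule l(1))
    show "(\<integral>\<omega>. (\<Sum>k=1..n. ?l k \<omega>) \<partial>M) = (\<Sum>k=1..n. \<delta> k / 2 * mean_energy (time (k - 1)))"
      by (subst Bochner_Integration.integral_sum, erule l(1)) (rule sum.cong[OF refl l(2)])
  qed
  have mln: "(\<lambda>y. ln (?p y / ?q y)) \<in> borel_measurable (\<Pi>\<^sub>M k\<in>{1..n}. borel)" by measurable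
  have int: "integrable (path_law M n Y) (\<lambda>y. ln (?p y / ?q y))"
    unfolding path_law_def
    by (subst integrable_distr_eq[OF mY mln], subst ln_eq)
       (rule Bochner_Integration.integrable_diff[OF lnY(1) sum_l(1)])
  have "KL_div (path_law M n Y) (path_law M' n (Zproc \<delta> f N')) = ereal (\<integral>y. ln (?p y / ?q y) \<partial>path_law M n Y)"
    unfolding Q path_law_Y
    by (rule KL_div_density) (use sf int p_pos in \<open>auto simp: path_law_Y less_imp_le\<close>)
  also have "(\<integral>y. ln (?p y / ?q y) \<partial>path_law M n Y)
      = (\<integral>\<omega>. ln (tilt_norm \<mu> (time n) (Y n \<omega>)) - (\<Sum>k=1..n. ?l k \<omega>) \<partial>M)"
    unfolding path_law_def by (subst integral_distr[OF mY mln], subst ln_eq) (rule refl)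
  also have "\<dots> = log_norm_energy (time n) - (\<Sum>k=1..n. \<delta> k / 2 * mean_energy (time (k - 1)))"
    unfolding Bochner_Integration.integral_diff[OF lnY(1) sum_l(1)] lnY(2) sum_l(2) ..
  \<comment> \<open>The prior energy is added to every summand and to \<open>info\<close> alike; it
    cancels because the steps sum to \<open>time n\<close>.\<close>
  also have "\<dots> = (\<Sum>k=1..n. \<delta> k / 2 * mmse \<mu> (time (k - 1))) - info (time n)"
  proof -
    have "(\<Sum>k=1..n. \<delta> k / 2 * mmse \<mu> (time (k - 1)))
        = (\<Sum>k=1..n. \<delta> k / 2 * prior_energy - \<delta> k / 2 * mean_energy (time (k - 1)))"
    proof (rule sum.cong)
      fix k assume "k \<in> {1..n}"
      then have "0 \<le> time (k - 1)" by (intro time_nonneg) auto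
      then show "\<delta> k / 2 * mmse \<mu> (time (k - 1)) = \<delta> k / 2 * prior_energy - \<delta> k / 2 * mean_energy (time (k - 1))"
        by (simp add: mmse_eq right_diff_distrib)
    qed simp
    also have "\<dots> = time n / 2 * prior_energy - (\<Sum>k=1..n. \<delta> k / 2 * mean_energy (time (k - 1)))"
      by (simp add: sum_subtractf time_def sum_distrib_right sum_divide_distrib)
    finally show ?thesis by (simp add: info_def)
  qed
  finally show ?thesis .
qed

lemma info_ge_sum_mmse: "k \<le> n \<Longrightarrow> (\<Sum>j=1..k. \<delta> j / 2 * mmse \<mu> (time j)) \<le> info (time k)"
proof (induction k)
  case 0
  then show ?case by (simp add: info_0)
next
  case (Suc k)
  have "\<delta> (Suc k) / 2 * mmse \<mu> (time (Suc k)) \<le> info (time (Suc k)) - info (time k)"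
    using info_increment[of "time k" "time (Suc k)"] time_nonneg[of k] \<delta>_pos[of "Suc k"] Suc.prems by simp
  then show ?case using Suc by simp
qed

end

section \<open>Algebra of the geometric grid\<close>

lemma geometric_grid_bound:
  fixes m :: "nat \<Rightarrow> real"
  assumes \<alpha>: "0 < \<alpha>" "\<alpha> ^ n \<noteq> 1"
    and lower: "(\<Sum>k=1..n. tstep \<alpha> n T k / 2 * m k) \<le> i"
  shows "(\<Sum>k=1..n. tstep \<alpha> n T k / 2 * m (k - 1)) - i
    \<le> (\<alpha> - 1) * (T * (m 0 - m n) / (2 * (\<alpha> ^ n - 1)) + i - T * m n / 2)"
proof -
  \<comment> \<open>The length of the first step.\<close>
  define c where "c = (\<alpha> - 1) * T / (\<alpha> ^ n - 1)"
  have step: "tstep \<alpha> n T (Suc k) = \<alpha> ^ k * c" for k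
    by (simp add: tstep_def tgrid_def c_def diff_divide_distrib[symmetric] left_diff_distrib[symmetric] algebra_simps)
  \<comment> \<open>Reindexing by one step multiplies the weights by \<alpha>, since
    \<open>\<alpha> * tstep \<alpha> n T l = \<alpha> ^ l * c\<close> for positive \<open>l\<close>;
    the two extra terms are the ends of the grid.\<close>
  have shift: "(\<Sum>k=1..l. tstep \<alpha> n T k / 2 * m (k - 1))
      = c / 2 * m 0 + \<alpha> * (\<Sum>k=1..l. tstep \<alpha> n T k / 2 * m k) - \<alpha> ^ l * c / 2 * m l" for l
    by (induction l) (simp_all add: step algebra_simps)
  have c: "c * (\<alpha> ^ n - 1) = (\<alpha> - 1) * T" using \<alpha> by (simp add: c_def)
  have "\<alpha> * (\<Sum>k=1..n. tstep \<alpha> n T k / 2 * m k) \<le> \<alpha> * i"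
    using lower \<alpha> by (intro mult_left_mono) auto
  then have "(\<Sum>k=1..n. tstep \<alpha> n T k / 2 * m (k - 1)) - i
      \<le> c / 2 * (m 0 - m n) + (\<alpha> - 1) * i - c * (\<alpha> ^ n - 1) / 2 * m n"
    unfolding shift by (simp add: algebra_simps diff_divide_distrib)
  also have "\<dots> = (\<alpha> - 1) * (T * (m 0 - m n) / (2 * (\<alpha> ^ n - 1)) + i - T * m n / 2)"
    unfolding c by (simp add: c_def algebra_simps diff_divide_distrib)
  finally show ?thesis .
qed

theorem theorem2:
  fixes \<mu> :: "'a::euclidean_space measure"
    and n :: nat and T \<alpha> :: real
    and M :: "'b measure" and X :: "'b \<Rightarrow> 'a" and N :: "nat \<Rightarrow> 'b \<Rightarrow> 'a"
    and M' :: "'c measure" and Nt :: "nat \<Rightarrow> 'c \<Rightarrow> 'a"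
    and f :: "nat \<Rightarrow> 'a \<Rightarrow> 'a"
  assumes mu_prob: "prob_space \<mu>" and mu_sets: "sets \<mu> = sets borel"
    and mu_moment: "integrable \<mu> (\<lambda>x. (norm x)\<^sup>2)"
    and n_pos: "n \<ge> 1" and T_pos: "T > 0" and alpha_pos: "\<alpha> > 0" and alpha_ne: "\<alpha> \<noteq> 1"
    and M_prob: "prob_space M"
    and X_meas: "X \<in> borel_measurable M" and X_law: "distr M borel X = \<mu>"
    and N_meas: "\<And>k. k \<in> {1..n} \<Longrightarrow> N k \<in> borel_measurable M"
    and N_law: "\<And>k. k \<in> {1..n} \<Longrightarrow> distr M borel (N k) = std_gauss"
    and indep: "prob_space.indep_vars M (\<lambda>_. borel)
                  (\<lambda>i. case i of None \<Rightarrow> X | Some k \<Rightarrow> N k) (insert None (Some ` {1..n}))"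
    and M'_prob: "prob_space M'"
    and Nt_meas: "\<And>k. k \<in> {1..n} \<Longrightarrow> Nt k \<in> borel_measurable M'"
    and Nt_law: "\<And>k. k \<in> {1..n} \<Longrightarrow> distr M' borel (Nt k) = std_gauss"
    and Nt_indep: "prob_space.indep_vars M' (\<lambda>_. borel) Nt {1..n}"
    and f_meas: "\<And>k. k \<in> {1..n} \<Longrightarrow> f k \<in> borel_measurable borel"
    and f_cond_mean: "\<And>k b. k \<in> {1..n} \<Longrightarrow> b \<in> Basis \<Longrightarrow>
          AE \<omega> in M. f k (Yproc (tstep \<alpha> n T) X N (k - 1) \<omega>) \<bullet> b
            = real_cond_exp M (vimage_algebra (space M) (Yproc (tstep \<alpha> n T) X N (k - 1)) borel)
                (\<lambda>\<omega>'. X \<omega>' \<bullet> b) \<omega>"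
  shows "KL_div (path_law M n (Yproc (tstep \<alpha> n T) X N))
                (path_law M' n (Zproc (tstep \<alpha> n T) f Nt))
         \<le> ereal (\<alpha> - 1) *
             (ereal (T * (mmse \<mu> 0 - mmse \<mu> T) / (2 * (\<alpha> ^ n - 1)))
              + mutual_info \<mu> T - ereal (T * mmse \<mu> T / 2))"
proof -
  \<comment> \<open>Numerator and denominator have the same sign on either side of 1, so all steps
    are positive.\<close>
  have \<alpha>n: "0 < (\<alpha> - 1) / (\<alpha> ^ n - 1)"
  proof (cases "1 < \<alpha>")
    case True
    then show ?thesis using n_pos by (simp add: one_less_power)
  next
    case False
    then have "\<alpha> < 1" using alpha_ne by simp
    moreover have "\<alpha> ^ n < 1"
      using power_strict_decreasing[of 0 n \<alpha>] n_pos alpha_pos \<open>\<alpha> < 1\<close> by simp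
    ultimately show ?thesis by (intro divide_neg_neg) auto
  qed
  then have ne: "\<alpha> ^ n \<noteq> 1" by auto
  have step_pos: "0 < tstep \<alpha> n T k" if k: "k \<in> {1..n}" for k
  proof -
    obtain j where "k = Suc j" using k by (cases k) auto
    then have eq: "tstep \<alpha> n T k = \<alpha> ^ j * ((\<alpha> - 1) / (\<alpha> ^ n - 1)) * T"
      by (simp add: tstep_def tgrid_def diff_divide_distrib[symmetric] left_diff_distrib[symmetric] algebra_simps)
    show ?thesis unfolding eq by (intro mult_pos_pos zero_less_power alpha_pos \<alpha>n T_pos)
  qed
  interpret noisy_observation \<mu> M X N "tstep \<alpha> n T" n
    using assms step_pos by (intro noisy_observation.intro square_integrable_prior.intro
        square_integrable_prior_axioms.intro noisy_observation_axioms.intro)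
  have time_eq: "time k = tgrid \<alpha> n T k" for k
    by (induction k) (simp_all add: tgrid_def[of _ _ _ 0] tstep_def[of _ _ _ "Suc _"])
  have time_n: "time n = T" using ne by (simp add: time_eq tgrid_def)
  have "KL_div (path_law M n Y) (path_law M' n (Zproc (tstep \<alpha> n T) f Nt))
      = ereal ((\<Sum>k=1..n. tstep \<alpha> n T k / 2 * mmse \<mu> (time (k - 1))) - info T)"
    using KL_div_path_law[OF M'_prob Nt_law Nt_indep f_meas f_cond_mean] by (simp only: time_n)
  also have "\<dots> \<le> ereal ((\<alpha> - 1) * (T * (mmse \<mu> 0 - mmse \<mu> T) / (2 * (\<alpha> ^ n - 1)) + info T - T * mmse \<mu> T / 2))"
    using geometric_grid_bound[OF alpha_pos ne, of T "\<lambda>k. mmse \<mu> (time k)" "info T"]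
      info_ge_sum_mmse[of n] by (simp add: time_n)
  \<comment> \<open>The mutual information is finite, so the extended-real expression is an ordinary
    real one.\<close>
  also have "\<dots> = ereal (\<alpha> - 1) * (ereal (T * (mmse \<mu> 0 - mmse \<mu> T) / (2 * (\<alpha> ^ n - 1)))
              + mutual_info \<mu> T - ereal (T * mmse \<mu> T / 2))"
    using T_pos by (simp add: mutual_info_eq)
  finally show ?thesis .
qed

end
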